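(* Let $N=3$, $\kappa_3=1$, $\mathcal{L}=\partial_x^3+u_1(x)\partial_x+u_0(x)$, and let $\{H_k^j(x,y)\}_{k\in\mathbb{N},\,j\in\{0,1\}}$ denote the Hadamard's coefficients in the expansion of the heat kernel of $\partial_tv=\mathcal{L}v$. The Boussinesq hierarchy $$\frac{\partial\mathcal{L}}{\partial s_m}=\left[(\mathcal{L}^{m/3})_+,\mathcal{L}\right]$$ is equivalent to the equations $$\frac{\partial u_1}{\partial s_{3k-2}}=3\,(1/3)_k\,\frac{\partial}{\partial x}H_k^1(x,x),\qquad \frac{\partial u_0}{\partial s_{3k-2}}=3\,(1/3)_k\,\frac{\partial}{\partial x}\left[H_k^0(x,x)+\frac{\partial H_k^1(x,y)}{\partial x}\Big|_{y=x}\right],$$ and $$\frac{\partial u_1}{\partial s_{3k-1}}=3\,(2/3)_k\,\frac{\partial}{\partial x}H_k^0(x,x),\qquad \frac{\partial u_0}{\partial s_{3k-1}}=3\,(2/3)_k\,\frac{\partial}{\partial x}\left[\frac{\partial H_k^0(x,y)}{\partial x}\Big|_{y=x}\right],$$ where $k\in\mathbb{N}$. (The first pair of equations corresponds to $m=3k-2$ and the second pair to $m=3k-1$; the flows with $m$ divisible by $3$ are trivial, their right-hand side being $0$.)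
   Context: The coefficients $u_0,u_1$ are smooth functions of $x$, depending in addition on the times $s_m$; $H_k^j$ is computed for each fixed value of the times. $(a)_k=a(a+1)\cdots(a+k-1)$ is the Pochhammer symbol. Let $A_3(z)=\frac{1}{\sqrt[3]{3}}\mathrm{Ai}\left(-\frac{z}{\sqrt[3]{3}}\right)$, where $\mathrm{Ai}$ is the Airy function; it satisfies $A_3''(z)=-\frac13zA_3(z)$. The heat kernel of $\partial_tv=\mathcal{L}v$ is the formal expansion ($t>0$) $$\mathcal{H}(x,y,t)=\frac{1}{\sqrt[3]{t}}A_3\left(\frac{x-y}{\sqrt[3]{t}}\right)\left(1+\sum_{k=1}^{\infty}H_k^0(x,y)t^k\right)+\frac{1}{\sqrt[3]{t^2}}A_3'\left(\frac{x-y}{\sqrt[3]{t}}\right)\sum_{k=1}^{\infty}H_k^1(x,y)t^k,$$ where the Hadamard's coefficients $H_k^j$ are uniquely determined by: (a) for fixed $y$, $\mathcal{H}(x,y,t)$ formally solves $\partial_tv=\mathcal{L}v$ (i.e. after substitution and elimination of $A_3''$ and higher derivatives by the Airy equation, the coefficients of each $t^{-(j+1)/3}A_3^{(j)}\left(\frac{x-y}{\sqrt[3]{t}}\right)t^k$, $j\in\{0,1\}$, on both sides coincide); (b) the $H_k^j(x,y)$ are smooth in a neighborhood of the diagonal $y=x$. Formal pseudo-differential operators are series $R=\sum_{i\le m}r_i(x)\partial_x^i$, multiplied via $\partial_x^k\cdot r(x)=\sum_{i\ge0}\binom{k}{i}r^{(i)}(x)\partial_x^{k-i}$, $k\in\mathbb{Z}$;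 $R_+=\sum_{i\ge0}r_i\partial_x^i$. $\mathcal{L}^{1/3}=\partial_x+\sum_{i\le0}p_i\partial_x^i$ is the unique operator of this form whose cube is $\mathcal{L}$, and $\mathcal{L}^{m/3}=(\mathcal{L}^{1/3})^m$. In $\frac{\partial}{\partial x}H_k^j(x,x)$ the function $H_k^j$ is first restricted to the diagonal and then differentiated. *)

theory Defs
  imports "HOL-Analysis.Analysis"
begin

section \<open>Smooth functions\<close>

text \<open>The directional derivatives are iterated as total functions; the notion is meant for open \<open>S\<close>.\<close>

primrec higher_differentiable_on ::
  "'b::real_normed_vector set \<Rightarrow> ('b \<Rightarrow> 'a::real_normed_vector) \<Rightarrow> nat \<Rightarrow> bool" where
  "higher_differentiable_on S f 0 \<longleftrightarrow> continuous_on S f"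
| "higher_differentiable_on S f (Suc n) \<longleftrightarrow>
     (\<forall>x\<in>S. f differentiable (at x)) \<and>
     (\<forall>v. higher_differentiable_on S (\<lambda>x. frechet_derivative f (at x) v) n)"

definition smooth_on ::
  "'b::real_normed_vector set \<Rightarrow> ('b \<Rightarrow> 'a::real_normed_vector) \<Rightarrow> bool" where
  "smooth_on S f \<longleftrightarrow> (\<forall>n. higher_differentiable_on S f n)"

definition Dx :: "(real \<Rightarrow> 'a::real_normed_vector) \<Rightarrow> real \<Rightarrow> 'a" where
  "Dx f = (\<lambda>x. vector_derivative f (at x))"


section \<open>Formal pseudo-differential operators\<close>

text \<open>
  \<open>R :: int \<Rightarrow> real \<Rightarrow> 'a\<close> stands for the series \<open>\<Sum>i. R i x \<partial>\<^sub>x\<^sup>i\<close>. The coefficients are functions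
  on an open set \<open>X\<close> of reals, so operators are only compared at points of \<open>X\<close>.
  The scalars \<open>'a::real_normed_field\<close> cover real-valued and complex-valued coefficients.
\<close>

type_synonym 'a psido = "int \<Rightarrow> real \<Rightarrow> 'a"

definition psido :: "real set \<Rightarrow> 'a::real_normed_field psido \<Rightarrow> bool" where
  "psido X R \<longleftrightarrow> (\<exists>m. \<forall>i>m. \<forall>x\<in>X. R i x = 0) \<and> (\<forall>i. smooth_on X (R i))"

definition psido_eq :: "real set \<Rightarrow> 'a::real_normed_field psido \<Rightarrow> 'a psido \<Rightarrow> bool" where
  "psido_eq X R S \<longleftrightarrow> (\<forall>i. \<forall>x\<in>X. R i x = S i x)"

text \<open>
  \<open>psido_term R S n x (k, i)\<close> is the contribution of \<open>R k \<partial>\<^sup>k \<cdot> S l \<partial>\<^sup>l\<close>, with \<open>l = n - k + i\<close>,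
  to the coefficient of \<open>\<partial>\<^sup>n = \<partial>\<^sup>k\<^sup>+\<^sup>l\<^sup>-\<^sup>i\<close>. At points of \<open>X\<close> only finitely many of these
  contributions are nonzero (lemma \<open>finite_psido_term\<close> below), and the product adds those up.
\<close>

definition psido_term ::
  "'a::real_normed_field psido \<Rightarrow> 'a psido \<Rightarrow> int \<Rightarrow> real \<Rightarrow> int \<times> nat \<Rightarrow> 'a" where
  "psido_term R S n x =
     (\<lambda>(k, i). (of_int k gchoose i) * R k x * (Dx ^^ i) (S (n - k + int i)) x)"

definition psido_mult ::
  "'a::real_normed_field psido \<Rightarrow> 'a psido \<Rightarrow> 'a psido" where
  "psido_mult R S n x = (\<Sum>p | psido_term R S n x p \<noteq> 0. psido_term R S n x p)"

definition psido_one :: "'a::real_normed_field psido" where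
  "psido_one i x = (if i = 0 then 1 else 0)"

primrec psido_power :: "'a::real_normed_field psido \<Rightarrow> nat \<Rightarrow> 'a psido" where
  "psido_power R 0 = psido_one"
| "psido_power R (Suc m) = psido_mult R (psido_power R m)"

definition psido_plus :: "'a::real_normed_field psido \<Rightarrow> 'a psido" where
  "psido_plus R i x = (if i \<ge> 0 then R i x else 0)"

definition psido_commutator ::
  "'a::real_normed_field psido \<Rightarrow> 'a psido \<Rightarrow> 'a psido" where
  "psido_commutator R S i x = psido_mult R S i x - psido_mult S R i x"

definition Lop ::
  "(real \<Rightarrow> 'a::real_normed_field) \<Rightarrow> (real \<Rightarrow> 'a) \<Rightarrow> 'a psido" where
  "Lop u0 u1 i x = (if i = 3 then 1 else if i = 1 then u1 x else if i = 0 then u0 x else 0)"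

definition is_cube_root ::
  "real set \<Rightarrow> 'a::real_normed_field psido \<Rightarrow> 'a psido \<Rightarrow> bool" where
  "is_cube_root X L P \<longleftrightarrow>
     psido X P \<and> (\<forall>x\<in>X. P 1 x = 1) \<and> (\<forall>i>1. \<forall>x\<in>X. P i x = 0) \<and>
     psido_eq X (psido_power P 3) L"

lemma funpow_Dx_eq_0:
  assumes "open X" "\<And>x. x \<in> X \<Longrightarrow> f x = 0" "x \<in> X"
  shows "(Dx ^^ i) f x = 0"
  using assms(3)
proof (induction i arbitrary: x)
  case 0
  then show ?case using assms(2) by simp
next
  case (Suc i)
  have "((Dx ^^ i) f has_vector_derivative 0) (at x)"
    by (rule has_vector_derivative_transform_within_open[OF has_vector_derivative_const assms(1) Suc.prems])
       (simp add: Suc.IH)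
  then have "Dx ((Dx ^^ i) f) x = 0"
    unfolding Dx_def[of "(Dx ^^ i) f"] by (rule vector_derivative_at)
  then show ?case by simp
qed

lemma finite_psido_term:
  assumes "open X" "psido X R" "psido X S" "x \<in> X"
  shows "finite {p. psido_term R S n x p \<noteq> 0}"
proof -
  obtain M where M: "\<And>i. i > M \<Longrightarrow> R i x = 0"
    using assms(2,4) unfolding psido_def by blast
  obtain N where N: "\<And>i y. i > N \<Longrightarrow> y \<in> X \<Longrightarrow> S i y = 0"
    using assms(3) unfolding psido_def by blast
  have "{p. psido_term R S n x p \<noteq> 0} \<subseteq> {n - N..M} \<times> {..nat (M + N - n)}"
  proof
    fix p assume "p \<in> {p. psido_term R S n x p \<noteq> 0}"
    then obtain k i where p: "p = (k, i)"
      and a: "R k x \<noteq> 0" "(Dx ^^ i) (S (n - k + int i)) x \<noteq> 0"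
      by (cases p) (auto simp: psido_term_def)
    have "k \<le> M" using M a(1) by force
    moreover have "n - k + int i \<le> N"
      using funpow_Dx_eq_0[OF assms(1) N assms(4)] a(2) by force
    ultimately show "p \<in> {n - N..M} \<times> {..nat (M + N - n)}" unfolding p by auto
  qed
  then show ?thesis by (rule finite_subset) simp
qed


section \<open>Formal heat kernel expansions and Hadamard's coefficients\<close>

text \<open>
  \<open>V :: int \<Rightarrow> nat \<Rightarrow> real \<Rightarrow> real \<Rightarrow> 'a\<close> stands for the formal expansion
  \<open>\<Sum>n. (V n 0 x y e\<^sub>0 + V n 1 x y e\<^sub>1) t\<^sup>n\<close> with
  \<open>e\<^sub>j = t\<^sup>-\<^sup>(\<^sup>j\<^sup>+\<^sup>1\<^sup>)\<^sup>/\<^sup>3 A\<^sub>3\<^sup>(\<^sup>j\<^sup>)(\<xi>)\<close>, \<open>\<xi> = (x - y) / t\<^sup>1\<^sup>/\<^sup>3\<close>; only the indices \<open>j = 0, 1\<close> are used.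
  The Airy equation \<open>A\<^sub>3'' (z) = - z A\<^sub>3 (z) / 3\<close> eliminates the second and higher derivatives, which gives
   \<open>\<partial>\<^sub>x e\<^sub>0 = e\<^sub>1\<close>,
   \<open>\<partial>\<^sub>x e\<^sub>1 = - (x - y) / 3 \<cdot> t\<^sup>-\<^sup>1 e\<^sub>0\<close>,
   \<open>\<partial>\<^sub>t e\<^sub>0 = - 1/3 \<cdot> t\<^sup>-\<^sup>1 e\<^sub>0 - (x - y) / 3 \<cdot> t\<^sup>-\<^sup>1 e\<^sub>1\<close>,
   \<open>\<partial>\<^sub>t e\<^sub>1 = - 2/3 \<cdot> t\<^sup>-\<^sup>1 e\<^sub>1 + (x - y)\<^sup>2 / 9 \<cdot> t\<^sup>-\<^sup>2 e\<^sub>0\<close>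
  (lemma \<open>airy_basis_derivatives\<close> below). The operations \<open>formal_dx\<close> and \<open>formal_dt\<close> are the
  resulting term-by-term derivatives.
\<close>

lemma airy_basis_derivatives:
  fixes A A' :: "real \<Rightarrow> real" and t x y :: real
  assumes A: "\<And>z. (A has_real_derivative A' z) (at z)"
    and A': "\<And>z. (A' has_real_derivative - (1/3) * z * A z) (at z)"
    and t: "t > 0"
  defines "e0 \<equiv> \<lambda>x t. A ((x - y) / root 3 t) / root 3 t"
    and "e1 \<equiv> \<lambda>x t. A' ((x - y) / root 3 t) / (root 3 t)\<^sup>2"
  shows "((\<lambda>x. e0 x t) has_real_derivative e1 x t) (at x)"
    and "((\<lambda>x. e1 x t) has_real_derivative - ((x - y) / 3) / t * e0 x t) (at x)"
    and "((\<lambda>t. e0 x t) has_real_derivative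
            - (1/3) / t * e0 x t - (x - y) / 3 / t * e1 x t) (at t)"
    and "((\<lambda>t. e1 x t) has_real_derivative
            - (2/3) / t * e1 x t + (x - y)\<^sup>2 / 9 / t\<^sup>2 * e0 x t) (at t)"
proof -
  define r where "r = root 3 t"
  define z where "z = (x - y) / r"
  have r: "r > 0" and t_r: "t = r ^ 3"
    using t by (auto simp: r_def)
  have xy: "x - y = z * r" using r by (simp add: z_def)
  have zx: "((\<lambda>x. (x - y) / r) has_real_derivative 1 / r) (at x)"
    by (rule DERIV_cdivide) (auto intro!: derivative_eq_intros)
  have rt: "(root 3 has_real_derivative 1 / (3 * r\<^sup>2)) (at t)"
    using DERIV_real_root[of 3 t] t by (simp add: r_def inverse_eq_divide)
  have r2t: "((\<lambda>t. (root 3 t)\<^sup>2) has_real_derivative 2 / (3 * r)) (at t)"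
    by (rule DERIV_cong[OF DERIV_power[OF rt]])
       (use r in \<open>simp add: r_def[symmetric] power2_eq_square\<close>)
  have zt: "((\<lambda>t. (x - y) / root 3 t) has_real_derivative - z / (3 * r ^ 3)) (at t)"
    by (rule DERIV_cong[OF DERIV_divide[OF DERIV_const rt]])
       (use r in \<open>simp_all add: r_def[symmetric] xy power2_eq_square power3_eq_cube\<close>)
  note Ax = DERIV_chain2[OF A zx] and A'x = DERIV_chain2[OF A' zx]
  note At = DERIV_chain2[OF A zt] and A't = DERIV_chain2[OF A' zt]
  show "((\<lambda>x. e0 x t) has_real_derivative e1 x t) (at x)"
    unfolding e0_def e1_def r_def[symmetric]
    by (rule DERIV_cong[OF DERIV_cdivide[OF Ax]]) (simp add: power2_eq_square)
  show "((\<lambda>x. e1 x t) has_real_derivative - ((x - y) / 3) / t * e0 x t) (at x)"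
    unfolding e0_def e1_def r_def[symmetric] unfolding t_r
    by (rule DERIV_cong[OF DERIV_cdivide[OF A'x]])
       (use r in \<open>simp add: xy power2_eq_square power3_eq_cube\<close>)
  show "((\<lambda>t. e0 x t) has_real_derivative
            - (1/3) / t * e0 x t - (x - y) / 3 / t * e1 x t) (at t)"
    unfolding e0_def e1_def
    apply (rule DERIV_cong[OF DERIV_divide[OF At rt]])
    subgoal using t by simp
    unfolding r_def[symmetric] unfolding z_def[symmetric] unfolding xy t_r
    using r by (simp add: divide_simps) (simp add: eval_nat_numeral algebra_simps)
  show "((\<lambda>t. e1 x t) has_real_derivative
            - (2/3) / t * e1 x t + (x - y)\<^sup>2 / 9 / t\<^sup>2 * e0 x t) (at t)"
    unfolding e0_def e1_def
    apply (rule DERIV_cong[OF DERIV_divide[OF A't r2t]])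
    subgoal using t by simp
    unfolding r_def[symmetric] unfolding z_def[symmetric] unfolding xy t_r
    using r by (simp add: divide_simps) (simp add: eval_nat_numeral algebra_simps)
qed

type_synonym 'a expansion = "int \<Rightarrow> nat \<Rightarrow> real \<Rightarrow> real \<Rightarrow> 'a"

definition formal_dx :: "'a::real_normed_field expansion \<Rightarrow> 'a expansion" where
  "formal_dx V n j x y =
     Dx (\<lambda>x'. V n j x' y) x +
     (if j = 0 then - of_real ((x - y) / 3) * V (n + 1) 1 x y else V n 0 x y)"

definition formal_dt :: "'a::real_normed_field expansion \<Rightarrow> 'a expansion" where
  "formal_dt V n j x y =
     (if j = 0
      then (of_int (n + 1) - 1/3) * V (n + 1) 0 x y + of_real ((x - y)\<^sup>2 / 9) * V (n + 2) 1 x y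
      else (of_int (n + 1) - 2/3) * V (n + 1) 1 x y - of_real ((x - y) / 3) * V (n + 1) 0 x y)"

definition formal_L ::
  "(real \<Rightarrow> 'a::real_normed_field) \<Rightarrow> (real \<Rightarrow> 'a) \<Rightarrow> 'a expansion \<Rightarrow> 'a expansion" where
  "formal_L u0 u1 V n j x y =
     (formal_dx ^^ 3) V n j x y + u1 x * formal_dx V n j x y + u0 x * V n j x y"

definition heat_expansion ::
  "(nat \<Rightarrow> nat \<Rightarrow> real \<Rightarrow> real \<Rightarrow> 'a::real_normed_field) \<Rightarrow> 'a expansion" where
  "heat_expansion H n j x y =
     (if n < 0 then 0
      else if n = 0 then (if j = 0 then 1 else 0)
      else H (nat n) j x y)"

definition diagonal_nbhd :: "real set \<Rightarrow> (real \<times> real) set \<Rightarrow> bool" where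
  "diagonal_nbhd X U \<longleftrightarrow> open U \<and> (\<forall>x\<in>X. (x, x) \<in> U)"

text \<open>
  \<open>H k j x y\<close> is the Hadamard coefficient \<open>H\<^sub>k\<^sup>j(x, y)\<close>, \<open>k \<ge> 1\<close>, \<open>j \<in> {0, 1}\<close>. The
  neighbourhoods of the diagonal may depend on the coefficient considered.
\<close>

definition hadamard_coefficients ::
  "real set \<Rightarrow> (real \<Rightarrow> 'a::real_normed_field) \<Rightarrow> (real \<Rightarrow> 'a) \<Rightarrow>
   (nat \<Rightarrow> nat \<Rightarrow> real \<Rightarrow> real \<Rightarrow> 'a) \<Rightarrow> bool" where
  "hadamard_coefficients X u0 u1 H \<longleftrightarrow>
     (\<forall>n. \<forall>j\<in>{0, 1}. \<exists>U. diagonal_nbhd X U \<and>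
        (\<forall>(x, y)\<in>U. formal_dt (heat_expansion H) n j x y = formal_L u0 u1 (heat_expansion H) n j x y)) \<and>
     (\<forall>k\<ge>1. \<forall>j\<in>{0, 1}. \<exists>U. diagonal_nbhd X U \<and> smooth_on U (\<lambda>(x, y). H k j x y))"


section \<open>The Boussinesq hierarchy\<close>

text \<open>
  A point \<open>s :: nat \<Rightarrow> real\<close> collects the times \<open>s\<^sub>1, s\<^sub>2, \<dots>\<close>; the entry \<open>s 0\<close> is not used.
\<close>

definition time_deriv ::
  "nat \<Rightarrow> ((nat \<Rightarrow> real) \<Rightarrow> 'a::real_normed_vector) \<Rightarrow> (nat \<Rightarrow> real) \<Rightarrow> 'a" where
  "time_deriv m f s = vector_derivative (\<lambda>r. f (s(m := r))) (at (s m))"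

definition time_differentiable ::
  "nat \<Rightarrow> ((nat \<Rightarrow> real) \<Rightarrow> 'a::real_normed_vector) \<Rightarrow> (nat \<Rightarrow> real) \<Rightarrow> bool" where
  "time_differentiable m f s \<longleftrightarrow> (\<lambda>r. f (s(m := r))) differentiable (at (s m))"

text \<open>
  The \<open>m\<close>-th flow on times in \<open>T\<close> and positions in \<open>X\<close>, where \<open>P s\<close> is the cube root of the
  operator at the times \<open>s\<close>.
\<close>

definition boussinesq_flow ::
  "(nat \<Rightarrow> real) set \<Rightarrow> real set \<Rightarrow> ((nat \<Rightarrow> real) \<Rightarrow> 'a::real_normed_field psido) \<Rightarrow>
   ((nat \<Rightarrow> real) \<Rightarrow> 'a psido) \<Rightarrow> nat \<Rightarrow> bool" where
  "boussinesq_flow T X L P m \<longleftrightarrow>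
     (\<forall>s\<in>T. psido_eq X (\<lambda>i x. time_deriv m (\<lambda>s. L s i x) s)
                       (psido_commutator (psido_plus (psido_power (P s) m)) (L s)))"

end

theory Submission
  imports Defs
begin

text \<open>
  Fix a point \<open>y\<close> and let operators with coefficients expanded in powers of \<open>z = x - y\<close> act on
  formal symbols \<open>e\<^sub>i\<close> by \<open>\<partial> e\<^sub>i = e\<^sub>i\<^sub>+\<^sub>1\<close> and \<open>z e\<^sub>i = - i e\<^sub>i\<^sub>-\<^sub>1\<close>, so that \<open>e\<^sub>i\<close> behaves like
  \<open>z\<^sup>-\<^sup>i\<^sup>-\<^sup>1 / \<Gamma>(- i)\<close> and \<open>e\<^sub>0\<close> like the delta function at \<open>y\<close>. Put
  \<open>S\<^sub>m = \<Sum>k. (m/3) (m/3 - 1) \<dots> (m/3 - k + 1) (H\<^sub>k\<^sup>0 e\<^sub>m\<^sub>-\<^sub>3\<^sub>k + H\<^sub>k\<^sup>1 e\<^sub>m\<^sub>-\<^sub>3\<^sub>k\<^sub>+\<^sub>1)\<close> for natural \<open>m\<close>, with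
  \<open>H\<^sub>0\<^sup>0 = 1\<close> and \<open>H\<^sub>0\<^sup>1 = 0\<close>. The heat equation
  for the Hadamard expansion says exactly that \<open>L S\<^sub>m = S\<^sub>m\<^sub>+\<^sub>3\<close>, and \<open>S\<^sub>0 = e\<^sub>0\<close>; hence
  \<open>S\<^sub>m = P\<^sup>m e\<^sub>0\<close> for all \<open>m\<close> divisible by 3, where \<open>P\<close> is the cube root of \<open>L\<close>. The coefficients of
  \<open>e\<^sub>m\<^sub>-\<^sub>n\<close> on both sides are polynomials in \<open>m\<close>, so the identity holds for every \<open>m\<close>. The
  coefficients of \<open>e\<^sub>-\<^sub>1\<close> and \<open>e\<^sub>-\<^sub>2\<close> of \<open>P\<^sup>m e\<^sub>0\<close> are \<open>a\<close> and \<open>a' + b\<close> at \<open>y\<close>, where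
  \<open>P\<^sup>m = \<dots> + a \<partial>\<^sup>-\<^sup>1 + b \<partial>\<^sup>-\<^sup>2 + \<dots>\<close>, while \<open>[(P\<^sup>m)\<^sub>+, L] = 3 a' \<partial> + 3 (a' + b)'\<close>.
\<close>

unbundle no vec_syntax
unbundle fps_syntax

section \<open>Symbols of pseudo-differential operators over formal power series\<close>

lemma sum_triangle_swap:
  fixes F :: "nat \<Rightarrow> nat \<Rightarrow> 'b::comm_monoid_add"
  shows "(\<Sum>q\<le>n. \<Sum>i\<le>q. F q i) = (\<Sum>i\<le>n. \<Sum>k\<le>n - i. F (i + k) i)"
proof -
  have "(\<Sum>q\<le>n. \<Sum>i\<le>q. F q i) = (\<Sum>(q, i)\<in>Sigma {..n} (\<lambda>q. {..q}). F q i)"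
    by (subst sum.Sigma) auto
  also have "\<dots> = (\<Sum>(i, k)\<in>Sigma {..n} (\<lambda>i. {..n - i}). F (i + k) i)"
    by (rule sum.reindex_bij_witness[where i="\<lambda>(i, k). (i + k, i)" and j="\<lambda>(q, i). (i, q - i)"]) auto
  also have "\<dots> = (\<Sum>i\<le>n. \<Sum>k\<le>n - i. F (i + k) i)"
    by (subst sum.Sigma) auto
  finally show ?thesis .
qed

lemma fps_const_sum: "fps_const (\<Sum>i\<in>I. f i) = (\<Sum>i\<in>I. fps_const (f i))"
  by (rule fps_ext) (simp add: fps_sum_nth)

lemma fps_nth_deriv_fps_nth_deriv: "fps_nth_deriv k (fps_nth_deriv l f) = fps_nth_deriv (k + l) f"
  by (induction k) (simp_all add: fps_nth_deriv_commute del: fps_nth_deriv.simps(2))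

lemma fps_nth_deriv_mult:
  fixes f g :: "'a::comm_ring_1 fps"
  shows "fps_nth_deriv n (f * g) =
    (\<Sum>p\<le>n. of_nat (n choose p) * (fps_nth_deriv p f * fps_nth_deriv (n - p) g))"
proof (induction n)
  case (Suc n)
  let ?t = "\<lambda>p q. fps_nth_deriv p f * fps_nth_deriv q g"
  have "fps_nth_deriv (Suc n) (f * g) =
      (\<Sum>p\<le>n. of_nat (n choose p) * ?t (Suc p) (n - p)) + (\<Sum>p\<le>n. of_nat (n choose p) * ?t p (Suc n - p))"
    unfolding fps_nth_deriv_commute Suc
    by (simp add: fps_deriv_sum fps_of_nat[symmetric] sum.distrib[symmetric] Suc_diff_le algebra_simps
        fps_nth_deriv_commute del: fps_nth_deriv.simps(2))
  also have "(\<Sum>p\<le>n. of_nat (n choose p) * ?t (Suc p) (n - p)) =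
      (\<Sum>p\<le>Suc n. (if p = 0 then 0 else of_nat (n choose (p - 1))) * ?t p (Suc n - p))"
    by (simp add: sum.atMost_Suc_shift del: sum.atMost_Suc fps_nth_deriv.simps(2))
  also have "(\<Sum>p\<le>n. of_nat (n choose p) * ?t p (Suc n - p)) =
      (\<Sum>p\<le>Suc n. of_nat (n choose p) * ?t p (Suc n - p))"
    by (simp add: binomial_eq_0)
  finally show ?case
    by (simp only: sum.distrib[symmetric])
      (rule sum.cong, auto simp: distrib_right[symmetric] of_nat_add[symmetric] gr0_conv_Suc simp del: of_nat_add fps_nth_deriv.simps(2))
qed simp

text \<open>
  A sequence \<open>r\<close>, together with an order \<open>\<mu>\<close>, stands for \<open>\<Sum>n. r n \<partial>\<^sup>\<mu>\<^sup>-\<^sup>n\<close>. Then \<open>dpow_mult \<mu> t\<close> is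
  \<open>\<partial>\<^sup>\<mu> \<cdot> t\<close>, and \<open>symb_mult \<mu> r s\<close> is the product of \<open>r\<close>, of order \<open>\<mu>\<close>, with \<open>s\<close>; neither depends on
  the order of the right factor.
\<close>

definition dpow_mult :: "'a::field_char_0 \<Rightarrow> (nat \<Rightarrow> 'a fps) \<Rightarrow> nat \<Rightarrow> 'a fps" where
  "dpow_mult \<mu> t n = (\<Sum>l\<le>n. fps_const (\<mu> gchoose l) * fps_nth_deriv l (t (n - l)))"

definition symb_mult :: "'a::field_char_0 \<Rightarrow> (nat \<Rightarrow> 'a fps) \<Rightarrow> (nat \<Rightarrow> 'a fps) \<Rightarrow> nat \<Rightarrow> 'a fps" where
  "symb_mult \<mu> r s n = (\<Sum>i\<le>n. r i * dpow_mult (\<mu> - of_nat i) s (n - i))"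

lemma dpow_mult_add:
  "dpow_mult \<mu> (\<lambda>n. s n + t n) n = dpow_mult \<mu> s n + dpow_mult \<mu> t n"
  by (simp add: dpow_mult_def fps_nth_deriv_add algebra_simps sum.distrib)

lemma dpow_mult_0: "dpow_mult \<mu> (\<lambda>n. 0) n = 0"
  by (simp add: dpow_mult_def)

lemma dpow_mult_sum:
  "finite I \<Longrightarrow> dpow_mult \<mu> (\<lambda>n. \<Sum>i\<in>I. t i n) n = (\<Sum>i\<in>I. dpow_mult \<mu> (t i) n)"
  by (induction I rule: finite_induct) (simp_all add: dpow_mult_0 dpow_mult_add)

text \<open>Collecting the terms by the total number of derivatives, the binomial coefficients
  combine by Vandermonde's convolution, which holds for arbitrary scalar exponents.\<close>

lemma dpow_mult_dpow_mult: "dpow_mult \<mu> (dpow_mult \<nu> t) n = dpow_mult (\<mu> + \<nu>) t n"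
proof -
  have "dpow_mult \<mu> (dpow_mult \<nu> t) n =
     (\<Sum>l\<le>n. \<Sum>p\<le>n - l. fps_const ((\<mu> gchoose l) * (\<nu> gchoose (l + p - l))) * fps_nth_deriv (l + p) (t (n - (l + p))))"
    by (simp add: dpow_mult_def fps_nth_deriv_sum fps_nth_deriv_mult_const_left fps_nth_deriv_fps_nth_deriv
        sum_distrib_left mult.assoc[symmetric])
  also have "\<dots> = (\<Sum>q\<le>n. \<Sum>l\<le>q. fps_const ((\<mu> gchoose l) * (\<nu> gchoose (q - l))) * fps_nth_deriv q (t (n - q)))"
    by (rule sum_triangle_swap[symmetric])
  also have "\<dots> = dpow_mult (\<mu> + \<nu>) t n"
    unfolding dpow_mult_def gbinomial_Vandermonde[symmetric] atMost_atLeast0[symmetric]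
    by (simp add: fps_const_sum sum_distrib_right)
  finally show ?thesis .
qed

text \<open>Leibniz' rule distributes the derivatives over \<open>f\<close> and \<open>t\<close>.
  Trinomial revision then splits off the binomial coefficient of the \<open>p\<close> derivatives
  falling on \<open>f\<close>, and the rest is the action of a power of order
  \<open>\<mu> - p\<close> on \<open>t\<close>.\<close>

lemma dpow_mult_mult:
  "dpow_mult \<mu> (\<lambda>n. f * t n) n =
    (\<Sum>p\<le>n. fps_const (\<mu> gchoose p) * fps_nth_deriv p f * dpow_mult (\<mu> - of_nat p) t (n - p))"
proof -
  have "dpow_mult \<mu> (\<lambda>n. f * t n) n =
    (\<Sum>l\<le>n. \<Sum>p\<le>l. fps_const ((\<mu> gchoose l) * of_nat (l choose p)) * (fps_nth_deriv p f * fps_nth_deriv (l - p) (t (n - l))))"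
    by (simp add: dpow_mult_def fps_nth_deriv_mult sum_distrib_left fps_of_nat[symmetric]
        mult.assoc[symmetric])
  also have "\<dots> = (\<Sum>p\<le>n. \<Sum>k\<le>n - p. fps_const ((\<mu> gchoose (p + k)) * of_nat ((p + k) choose p)) *
       (fps_nth_deriv p f * fps_nth_deriv k (t (n - p - k))))"
    by (subst sum_triangle_swap) simp
  also have "\<dots> = (\<Sum>p\<le>n. fps_const (\<mu> gchoose p) * fps_nth_deriv p f * dpow_mult (\<mu> - of_nat p) t (n - p))"
  proof (rule sum.cong[OF refl], unfold dpow_mult_def sum_distrib_left, rule sum.cong[OF refl])
    fix p k
    have "(\<mu> gchoose (p + k)) * of_nat ((p + k) choose p) = (\<mu> gchoose p) * ((\<mu> - of_nat p) gchoose k)"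
      using gbinomial_trinomial_revision[of p "p + k" \<mu>] by (simp add: binomial_gbinomial)
    then show "fps_const ((\<mu> gchoose (p + k)) * of_nat ((p + k) choose p)) *
       (fps_nth_deriv p f * fps_nth_deriv k (t (n - p - k))) =
       fps_const (\<mu> gchoose p) * fps_nth_deriv p f * (fps_const (\<mu> - of_nat p gchoose k) * fps_nth_deriv k (t (n - p - k)))"
      by (simp add: fps_const_mult[symmetric] mult.assoc mult.left_commute del: fps_const_mult)
  qed
  finally show ?thesis .
qed

lemma dpow_mult_shift:
  "dpow_mult \<mu> (\<lambda>n. if j \<le> n then t (n - j) else 0) n = (if j \<le> n then dpow_mult \<mu> t (n - j) else 0)"
proof (cases "j \<le> n")
  case True
  have "dpow_mult \<mu> (\<lambda>n. if j \<le> n then t (n - j) else 0) n =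
     (\<Sum>l\<le>n - j. fps_const (\<mu> gchoose l) * fps_nth_deriv l (if j \<le> n - l then t (n - l - j) else 0))"
    unfolding dpow_mult_def by (rule sum.mono_neutral_right) auto
  also have "\<dots> = dpow_mult \<mu> t (n - j)"
    unfolding dpow_mult_def using True by (intro sum.cong) (auto simp: diff_commute add.commute)
  finally show ?thesis using True by simp
qed (auto simp: dpow_mult_def intro!: sum.neutral)

lemma dpow_mult_cong: "(\<And>k. k \<le> n \<Longrightarrow> s k = t k) \<Longrightarrow> dpow_mult \<mu> s n = dpow_mult \<mu> t n"
  by (simp add: dpow_mult_def)

text \<open>Both sides are brought to one sum over triples: an index in \<open>r\<close>, an index
  in \<open>s\<close>, and the number of derivatives that fall on the coefficient of
  \<open>s\<close>. What then acts on \<open>t\<close> is a single power of the derivation, by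
  \<open>dpow_mult_mult\<close> and \<open>dpow_mult_dpow_mult\<close>.\<close>

lemma symb_mult_assoc:
  "symb_mult (\<mu> + \<nu>) (symb_mult \<mu> r s) t n = symb_mult \<mu> r (symb_mult \<nu> s t) n"
proof -
  \<comment> \<open>Here \<open>i\<close> and \<open>j\<close> select coefficients of
    \<open>r\<close> and \<open>s\<close>, and \<open>p\<close> counts the derivatives of
    \<open>s j\<close>.\<close>
  define G where "G i j p = r i * (fps_const (\<mu> - of_nat i gchoose p) * fps_nth_deriv p (s j) *
    dpow_mult (\<mu> + \<nu> - of_nat (i + j + p)) t (n - (i + j + p)))" for i j p
  have "symb_mult (\<mu> + \<nu>) (symb_mult \<mu> r s) t n = (\<Sum>q\<le>n. \<Sum>i\<le>q. \<Sum>p\<le>q - i. G i (q - i - p) p)"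
    by (simp add: symb_mult_def dpow_mult_def[of _ s] sum_distrib_right sum_distrib_left G_def
        mult.assoc cong: sum.cong_simp)
  also have "\<dots> = (\<Sum>i\<le>n. \<Sum>q\<le>n - i. \<Sum>p\<le>q. G i (q - p) p)"
    by (subst sum_triangle_swap) simp
  also have "\<dots> = (\<Sum>i\<le>n. \<Sum>j\<le>n - i. \<Sum>p\<le>n - i - j. G i j p)"
  proof (rule sum.cong[OF refl])
    fix i
    have "(\<Sum>q\<le>n - i. \<Sum>p\<le>q. G i (q - p) p) = (\<Sum>q\<le>n - i. \<Sum>j\<le>q. G i j (q - j))"
    proof (rule sum.cong[OF refl])
      fix q
      show "(\<Sum>p\<le>q. G i (q - p) p) = (\<Sum>j\<le>q. G i j (q - j))"
        by (rule sum.reindex_bij_witness[where i="\<lambda>p. q - p" and j="\<lambda>p. q - p"]) auto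
    qed
    then show "(\<Sum>q\<le>n - i. \<Sum>p\<le>q. G i (q - p) p) = (\<Sum>j\<le>n - i. \<Sum>p\<le>n - i - j. G i j p)"
      by (subst (asm) sum_triangle_swap) simp
  qed
  also have "\<dots> = symb_mult \<mu> r (symb_mult \<nu> s t) n"
  proof -
    have "dpow_mult \<mu>' (symb_mult \<nu> s t) m = (\<Sum>j\<le>m. \<Sum>p\<le>m - j. fps_const (\<mu>' gchoose p) *
       fps_nth_deriv p (s j) * dpow_mult (\<mu>' + \<nu> - of_nat (j + p)) t (m - j - p))" for \<mu>' m
    proof -
      \<comment> \<open>The summation range is made independent of \<open>k\<close>, with zeros
        filled in, so that \<open>dpow_mult_sum\<close> applies.\<close>
      have "dpow_mult \<mu>' (symb_mult \<nu> s t) m =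
        dpow_mult \<mu>' (\<lambda>k. \<Sum>j\<le>m. if j \<le> k then s j * dpow_mult (\<nu> - of_nat j) t (k - j) else 0) m"
        by (rule dpow_mult_cong) (auto simp: symb_mult_def intro!: sum.mono_neutral_cong_left split: if_splits)
      also have "\<dots> = (\<Sum>j\<le>m. dpow_mult \<mu>' (\<lambda>k. s j * dpow_mult (\<nu> - of_nat j) t k) (m - j))"
        by (subst dpow_mult_sum) (auto simp: dpow_mult_shift[of _ _ "\<lambda>k. s _ * dpow_mult _ t k"])
      also have "\<dots> = (\<Sum>j\<le>m. \<Sum>p\<le>m - j. fps_const (\<mu>' gchoose p) *
       fps_nth_deriv p (s j) * dpow_mult (\<mu>' + \<nu> - of_nat (j + p)) t (m - j - p))"
        by (simp add: dpow_mult_mult dpow_mult_dpow_mult algebra_simps)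
      finally show ?thesis .
    qed
    then show ?thesis
      by (simp add: symb_mult_def[of \<mu>] sum_distrib_left G_def algebra_simps)
  qed
  finally show ?thesis .
qed

section \<open>Application to the delta function\<close>

lemma sum_triangle_commute:
  fixes F :: "nat \<Rightarrow> nat \<Rightarrow> 'b::comm_monoid_add"
  shows "(\<Sum>i\<le>n. \<Sum>k\<le>n - i. F i k) = (\<Sum>k\<le>n. \<Sum>i\<le>n - k. F i k)"
proof -
  have "(\<Sum>i\<le>n. \<Sum>k\<le>n - i. F i k) = (\<Sum>(i, k)\<in>Sigma {..n} (\<lambda>i. {..n - i}). F i k)"
    by (subst sum.Sigma) auto
  also have "\<dots> = (\<Sum>(k, i)\<in>Sigma {..n} (\<lambda>k. {..n - k}). F i k)"
    by (rule sum.reindex_bij_witness[where i="\<lambda>(i, k). (k, i)" and j="\<lambda>(i, k). (k, i)"]) auto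
  also have "\<dots> = (\<Sum>k\<le>n. \<Sum>i\<le>n - k. F i k)"
    by (subst sum.Sigma) auto
  finally show ?thesis .
qed

lemma dpow_mult_zero [simp]: "dpow_mult 0 r n = r n"
proof -
  have "dpow_mult 0 r n = (\<Sum>l\<in>{0}. fps_const (0 gchoose l) * fps_nth_deriv l (r (n - l)))"
    unfolding dpow_mult_def by (rule sum.mono_neutral_right) (auto simp: gbinomial_0_left)
  then show ?thesis by simp
qed

lemma dpow_mult_one: "dpow_mult 1 r n = r n + (if n = 0 then 0 else fps_deriv (r (n - 1)))"
proof (cases n)
  case (Suc m)
  have *: "(1 gchoose l) = (0::'a)" if "l > 1" for l
    using that binomial_gbinomial[of 1 l, where 'a = 'a] by (simp add: binomial_eq_0)
  have "dpow_mult 1 r n = (\<Sum>l\<in>{0, 1}. fps_const (1 gchoose l) * fps_nth_deriv l (r (n - l)))"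
    unfolding dpow_mult_def by (rule sum.mono_neutral_right) (auto simp: Suc intro!: * simp del: One_nat_def)
  then show ?thesis using Suc by simp
qed (simp add: dpow_mult_def)

definition symb_one :: "nat \<Rightarrow> 'a::field_char_0 fps" where
  "symb_one n = (if n = 0 then 1 else 0)"

lemma dpow_mult_symb_one [simp]: "dpow_mult \<mu> symb_one = symb_one"
proof
  fix n
  have "dpow_mult \<mu> symb_one n = (\<Sum>l\<in>{n}. fps_const (\<mu> gchoose l) * fps_nth_deriv l (symb_one (n - l)))"
    unfolding dpow_mult_def by (rule sum.mono_neutral_right) (auto simp: symb_one_def)
  then show "dpow_mult \<mu> symb_one n = symb_one n" by (simp add: symb_one_def)
qed

lemma symb_mult_symb_one_right [simp]: "symb_mult \<mu> r symb_one = r"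
proof
  fix n
  have "symb_mult \<mu> r symb_one n = (\<Sum>i\<in>{n}. r i * symb_one (n - i))"
    unfolding symb_mult_def dpow_mult_symb_one by (rule sum.mono_neutral_right) (auto simp: symb_one_def)
  then show "symb_mult \<mu> r symb_one n = r n" by (simp add: symb_one_def)
qed

lemma symb_mult_symb_one_left [simp]: "symb_mult 0 symb_one r = r"
proof
  fix n
  have "symb_mult 0 symb_one r n = (\<Sum>i\<in>{0}. symb_one i * dpow_mult (0 - of_nat i) r (n - i))"
    unfolding symb_mult_def by (rule sum.mono_neutral_right) (auto simp: symb_one_def)
  then show "symb_mult 0 symb_one r n = r n" by (simp add: symb_one_def)
qed

text \<open>
  \<open>delta_eval \<gamma> r n\<close> is the coefficient of \<open>e\<^sub>\<gamma>\<^sub>-\<^sub>n\<close> in \<open>\<Sum>i. r i e\<^sub>\<gamma>\<^sub>-\<^sub>i\<close>, where \<open>z\<^sup>l e\<^sub>i = (- i)\<^sub>l e\<^sub>i\<^sub>-\<^sub>l\<close>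
  with the Pochhammer symbol \<open>(- i)\<^sub>l\<close>.
\<close>

definition delta_eval :: "'a::field_char_0 \<Rightarrow> (nat \<Rightarrow> 'a fps) \<Rightarrow> nat \<Rightarrow> 'a" where
  "delta_eval \<gamma> r n = (\<Sum>i\<le>n. pochhammer (of_nat i - \<gamma>) (n - i) * (r i $ (n - i)))"

lemma delta_eval_add: "delta_eval \<gamma> (\<lambda>i. r i + s i) n = delta_eval \<gamma> r n + delta_eval \<gamma> s n"
  by (simp add: delta_eval_def algebra_simps sum.distrib)

lemma delta_eval_const_mult: "delta_eval \<gamma> (\<lambda>i. fps_const c * r i) n = c * delta_eval \<gamma> r n"
  by (simp add: delta_eval_def sum_distrib_left mult.left_commute)

lemma delta_eval_shift:
  "delta_eval \<gamma> (\<lambda>i. if j \<le> i then r (i - j) else 0) n =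
     (if j \<le> n then delta_eval (\<gamma> - of_nat j) r (n - j) else 0)"
proof (cases "j \<le> n")
  case True
  have "delta_eval \<gamma> (\<lambda>i. if j \<le> i then r (i - j) else 0) n =
    (\<Sum>i=j..n. pochhammer (of_nat i - \<gamma>) (n - i) * (r (i - j) $ (n - i)))"
    unfolding delta_eval_def by (rule sum.mono_neutral_cong_right) auto
  also have "\<dots> = (\<Sum>i\<le>n - j. pochhammer (of_nat i - (\<gamma> - of_nat j)) (n - j - i) * (r i $ (n - j - i)))"
    by (rule sum.reindex_bij_witness[where i="\<lambda>i. i + j" and j="\<lambda>i. i - j"])
       (use True in \<open>auto simp: of_nat_diff algebra_simps\<close>)
  finally show ?thesis using True by (simp add: delta_eval_def)
qed (auto simp: delta_eval_def)

lemma sum_atMost_shift_if: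
  fixes B :: "nat \<Rightarrow> 'b::comm_monoid_add"
  shows "(\<Sum>i\<le>n. if i = 0 then 0 else B (i - 1)) = (\<Sum>i<n. B i)"
proof (cases n)
  case (Suc m)
  show ?thesis unfolding Suc by (subst sum.atMost_Suc_shift) (simp add: lessThan_Suc_atMost)
qed simp

text \<open>This is the rule \<open>\<partial> e\<^sub>i = e\<^sub>i\<^sub>+\<^sub>1\<close>: after
  evaluation a derivation only raises the order. It is compatible with the reduction of powers of z
  because (a-1) + (d+1) = a+d, where a = i - \<gamma> and d = n - i - 1.\<close>

lemma delta_eval_dpow_mult_one: "delta_eval (\<gamma> + 1) (dpow_mult 1 r) n = delta_eval \<gamma> r n"
proof -
  \<comment> \<open>\<open>A i\<close> comes from \<open>r i\<close> itself, \<open>B i\<close> from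
    its derivative, which stands at index \<open>i + 1\<close>.\<close>
  define A where "A i = pochhammer (of_nat i - (\<gamma> + 1)) (n - i) * (r i $ (n - i))" for i
  define B where "B i = pochhammer (of_nat i - \<gamma>) (n - Suc i) * (of_nat (n - i) * r i $ (n - i))" for i
  have "delta_eval (\<gamma> + 1) (dpow_mult 1 r) n = (\<Sum>i\<le>n. A i + (if i = 0 then 0 else B (i - 1)))"
    unfolding delta_eval_def
    by (rule sum.cong) (auto simp: dpow_mult_one A_def B_def algebra_simps of_nat_diff gr0_conv_Suc Suc_diff_Suc)
  also have "\<dots> = (\<Sum>i\<le>n. A i) + (\<Sum>i<n. B i)"
    by (simp add: sum.distrib sum_atMost_shift_if)
  also have "\<dots> = (\<Sum>i<n. A i + B i) + A n"
    by (simp add: sum.distrib lessThan_Suc_atMost[symmetric])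
  also have "(\<Sum>i<n. A i + B i) = (\<Sum>i<n. pochhammer (of_nat i - \<gamma>) (n - i) * (r i $ (n - i)))"
  proof (rule sum.cong[OF refl])
    fix i assume "i \<in> {..<n}"
    then obtain d where n: "n = i + Suc d" by (metis add_Suc_right lessThan_iff less_iff_Suc_add)
    have 1: "pochhammer (of_nat i - (\<gamma> + 1)) (Suc d) = (of_nat i - \<gamma> - 1) * pochhammer (of_nat i - \<gamma>) d"
      by (simp add: pochhammer_rec algebra_simps)
    have 2: "pochhammer (of_nat i - \<gamma>) (Suc d) = (of_nat i - \<gamma> + of_nat d) * pochhammer (of_nat i - \<gamma>) d"
      by (simp add: pochhammer_rec')
    show "A i + B i = pochhammer (of_nat i - \<gamma>) (n - i) * (r i $ (n - i))"
      unfolding A_def B_def n by (simp add: 1 2) (simp add: algebra_simps)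
  qed
  also have "\<dots> + A n = delta_eval \<gamma> r n"
    by (simp add: delta_eval_def A_def lessThan_Suc_atMost[symmetric])
  finally show ?thesis .
qed

text \<open>The relation \<open>z e\<^sub>i + i e\<^sub>i\<^sub>-\<^sub>1 = 0\<close>, with \<open>f i\<close> multiplying the instance for \<open>e\<^sub>\<gamma>\<^sub>-\<^sub>i\<close>.\<close>

lemma delta_eval_fps_X_relation:
  "delta_eval \<gamma> (\<lambda>i. fps_X * f i + (if i = 0 then 0 else fps_const (\<gamma> - of_nat (i - 1)) * f (i - 1))) n = 0"
proof -
  \<comment> \<open>Both halves of the relation are expressed by the same \<open>A\<close>, at
    indices \<open>i\<close> and \<open>i - 1\<close> and with opposite signs, so the sum
    telescopes.\<close>
  define A where "A i = pochhammer (of_nat i - \<gamma>) (n - i) * (f i $ (n - Suc i))" for i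
  have "delta_eval \<gamma> (\<lambda>i. fps_X * f i + (if i = 0 then 0 else fps_const (\<gamma> - of_nat (i - 1)) * f (i - 1))) n
    = (\<Sum>i\<le>n. (if i = n then 0 else A i) + (if i = 0 then 0 else - A (i - 1)))"
    unfolding delta_eval_def
  proof (rule sum.cong[OF refl])
    fix i assume "i \<in> {..n}"
    then have i: "i \<le> n" by simp
    have 1: "pochhammer (of_nat i - \<gamma>) (n - i) * ((fps_X * f i) $ (n - i)) = (if i = n then 0 else A i)"
      using i by (auto simp: A_def)
    have 2: "pochhammer (of_nat i - \<gamma>) (n - i) * (fps_const (\<gamma> - of_nat (i - 1)) * f (i - 1)) $ (n - i) = - A (i - 1)"
      if "i \<noteq> 0"
    proof -
      obtain k where k: "i = Suc k" using \<open>i \<noteq> 0\<close> not0_implies_Suc by blast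
      obtain d where n: "n = k + Suc d" using i k by (metis add_Suc_right Suc_le_eq less_iff_Suc_add)
      show ?thesis unfolding A_def n k by (simp add: pochhammer_rec algebra_simps)
    qed
    show "pochhammer (of_nat i - \<gamma>) (n - i) * ((fps_X * f i + (if i = 0 then 0 else fps_const (\<gamma> - of_nat (i - 1)) * f (i - 1))) $ (n - i))
      = (if i = n then 0 else A i) + (if i = 0 then 0 else - A (i - 1))"
      using 1 2 by (simp add: distrib_left)
  qed
  also have "\<dots> = (\<Sum>i\<le>n. if i = n then 0 else A i) + (\<Sum>i<n. - A i)"
    by (simp only: sum.distrib sum_atMost_shift_if[of "\<lambda>i. - A i"])
  also have "(\<Sum>i\<le>n. if i = n then 0 else A i) = (\<Sum>i<n. A i)"
    by (simp add: lessThan_Suc_atMost[symmetric])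
  finally show ?thesis by (simp add: sum_negf)
qed

text \<open>Reducing a power of z in two stages splits its Pochhammer symbol. The form of the
  right-hand side matters: multiplication by \<open>u\<close> acts on evaluated symbols, although a
  symbol is not determined by its evaluation.\<close>

lemma delta_eval_mult:
  "delta_eval \<gamma> (\<lambda>i. u * r i) n =
    (\<Sum>l\<le>n. u $ l * pochhammer (of_nat (n - l) - \<gamma>) l * delta_eval \<gamma> r (n - l))"
proof -
  have "delta_eval \<gamma> (\<lambda>i. u * r i) n =
     (\<Sum>i\<le>n. \<Sum>l\<le>n - i. u $ l * pochhammer (of_nat (n - l) - \<gamma>) l * (pochhammer (of_nat i - \<gamma>) (n - l - i) * r i $ (n - l - i)))"
    unfolding delta_eval_def
  proof (rule sum.cong[OF refl])
    fix i assume i: "i \<in> {..n}"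
    show "pochhammer (of_nat i - \<gamma>) (n - i) * (u * r i) $ (n - i) =
      (\<Sum>l\<le>n - i. u $ l * pochhammer (of_nat (n - l) - \<gamma>) l * (pochhammer (of_nat i - \<gamma>) (n - l - i) * r i $ (n - l - i)))"
      unfolding fps_mult_nth sum_distrib_left atMost_atLeast0
    proof (rule sum.cong[OF refl])
      fix l assume "l \<in> {0..n - i}"
      then obtain d where n: "n = i + l + d" using i
        by (metis atLeastAtMost_iff atMost_iff le_add_diff_inverse add.assoc)
      have "pochhammer (of_nat i - \<gamma>) (l + d) = pochhammer (of_nat i - \<gamma>) d * pochhammer (of_nat i - \<gamma> + of_nat d) l"
        by (subst pochhammer_product[of d]) auto
      then show "pochhammer (of_nat i - \<gamma>) (n - i) * (u $ l * r i $ (n - i - l)) =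
        u $ l * pochhammer (of_nat (n - l) - \<gamma>) l * (pochhammer (of_nat i - \<gamma>) (n - l - i) * r i $ (n - l - i))"
        unfolding n by (simp add: algebra_simps)
    qed
  qed
  also have "\<dots> = (\<Sum>l\<le>n. u $ l * pochhammer (of_nat (n - l) - \<gamma>) l * delta_eval \<gamma> r (n - l))"
    by (subst sum_triangle_commute) (simp add: delta_eval_def sum_distrib_left)
  finally show ?thesis .
qed

lemma delta_eval_mult_cong:
  "(\<And>k. k \<le> n \<Longrightarrow> delta_eval \<gamma> r k = delta_eval \<gamma> s k) \<Longrightarrow>
    delta_eval \<gamma> (\<lambda>i. u * r i) n = delta_eval \<gamma> (\<lambda>i. u * s i) n"
  by (simp add: delta_eval_mult)

text \<open>Index \<open>n\<close> belongs to the derivation to the power 3 - n, which puts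
  \<open>u1\<close> at 2 and \<open>u0\<close> at 3.\<close>

definition L_symb :: "'a::field_char_0 fps \<Rightarrow> 'a fps \<Rightarrow> nat \<Rightarrow> 'a fps" where
  "L_symb u0 u1 n = (if n = 0 then 1 else if n = 2 then u1 else if n = 3 then u0 else 0)"

lemma symb_mult_L_symb:
  "symb_mult 3 (L_symb u0 u1) r n =
     dpow_mult 3 r n + (if 2 \<le> n then u1 * dpow_mult 1 r (n - 2) else 0) +
     (if 3 \<le> n then u0 * r (n - 3) else 0)"
proof -
  have "symb_mult 3 (L_symb u0 u1) r n =
    (\<Sum>i\<in>{i. i \<le> n \<and> i \<in> {0, 2, 3}}. L_symb u0 u1 i * dpow_mult (3 - of_nat i) r (n - i))"
    unfolding symb_mult_def by (rule sum.mono_neutral_right) (auto simp: L_symb_def)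
  also have "{i. i \<le> n \<and> i \<in> {0, 2, 3}} = {0} \<union> (if 2 \<le> n then {2} else {}) \<union> (if 3 \<le> n then {3} else {})"
    by auto
  finally show ?thesis
    by (auto simp: L_symb_def[of _ _ 0] L_symb_def[of _ _ 2] L_symb_def[of _ _ 3])
qed

lemma dpow_mult_3: "dpow_mult 3 r = dpow_mult 1 (dpow_mult 1 (dpow_mult 1 r))"
  by (rule ext) (simp add: dpow_mult_dpow_mult)

text \<open>The leading term only raises the order by 3, and the lower terms are shifted by 2 and 3
  places. Thus the action of the operator is expressed by operations that respect
  evaluation.\<close>

lemma delta_eval_symb_mult_L_symb:
  "delta_eval (\<alpha> + 3) (symb_mult 3 (L_symb u0 u1) r) n = delta_eval \<alpha> r n
     + (if 2 \<le> n then delta_eval (\<alpha> + 1) (\<lambda>i. u1 * dpow_mult 1 r i) (n - 2) else 0)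
     + (if 3 \<le> n then delta_eval \<alpha> (\<lambda>i. u0 * r i) (n - 3) else 0)"
proof -
  have "delta_eval (\<alpha> + 3) (dpow_mult 3 r) n = delta_eval \<alpha> r n"
    using delta_eval_dpow_mult_one[of "\<alpha> + 2" "dpow_mult 1 (dpow_mult 1 r)" n]
      delta_eval_dpow_mult_one[of "\<alpha> + 1" "dpow_mult 1 r" n] delta_eval_dpow_mult_one[of \<alpha> r n]
    by (simp add: dpow_mult_3 add.assoc)
  then show ?thesis
    unfolding symb_mult_L_symb[abs_def] delta_eval_add
      delta_eval_shift[where r = "\<lambda>i. u1 * dpow_mult 1 r i"] delta_eval_shift[where r = "\<lambda>i. u0 * r i"]
    by (simp add: add.commute)
qed

text \<open>Needed for the induction over multiples of 3, since powers of the cube root and Hadamard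
  symbols are compared only after evaluation.\<close>

lemma delta_eval_symb_mult_L_symb_cong:
  assumes "delta_eval \<alpha> r = delta_eval \<alpha> s"
  shows "delta_eval (\<alpha> + 3) (symb_mult 3 (L_symb u0 u1) r) = delta_eval (\<alpha> + 3) (symb_mult 3 (L_symb u0 u1) s)"
  by (rule ext)
    (simp add: delta_eval_symb_mult_L_symb delta_eval_mult delta_eval_dpow_mult_one assms)

section \<open>Powers of a symbol depend polynomially on the exponent\<close>

text \<open>Induction on a bound for the degree: the difference of a suitable multiple of x^(n+1)
  removes the coefficient of x^n, and characteristic 0 permits the division by n+1.\<close>

lemma poly_antidifference:
  fixes q :: "'a::field_char_0 poly"
  shows "\<exists>p. \<forall>x. poly p (x + 1) - poly p x = poly q x"
proof -
  have "\<exists>p. \<forall>x. poly p (x + 1) - poly p x = poly q x" if "\<And>i. i \<ge> n \<Longrightarrow> coeff q i = 0" for n and q :: "'a poly"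
    using that
  proof (induction n arbitrary: q)
    case 0
    then have "q = 0" by (intro poly_eqI) simp
    then show ?case by (intro exI[of _ 0]) simp
  next
    case (Suc n)
    \<comment> \<open>The difference (x+1)^(n+1) - x^(n+1) has leading coefficient n+1 in degree n,
      which this \<open>c\<close> normalises.\<close>
    define c where "c = coeff q n / of_nat (Suc n)"
    define d where "d = smult c ([:1, 1:] ^ Suc n - monom 1 (Suc n))"
    have "coeff (q - d) i = 0" if "i \<ge> n" for i
    proof (cases "i \<le> Suc n")
      case True
      then have "i = n \<or> i = Suc n" using that by auto
      then show ?thesis
        using True Suc.prems[of i]
        by (auto simp: d_def c_def coeff_linear_poly_power binomial_eq_0 simp del: power_Suc of_nat_Suc)
    next
      case False
      then have "coeff ([:1, 1::'a:] ^ Suc n) i = 0"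
        by (intro coeff_eq_0) (simp add: degree_linear_power del: power_Suc)
      then show ?thesis using False Suc.prems[of i] by (simp add: d_def del: power_Suc)
    qed
    from Suc.IH[OF this] obtain p where p: "\<And>x. poly p (x + 1) - poly p x = poly (q - d) x"
      by blast
    have "poly (p + monom c (Suc n)) (x + 1) - poly (p + monom c (Suc n)) x = poly q x" for x
      using p[of x] by (simp add: d_def poly_monom algebra_simps)
    then show ?case by blast
  qed
  from this[of "Suc (degree q)" q] show ?thesis by (simp add: coeff_eq_0)
qed

section \<open>Sequences that are polynomial in their index\<close>

definition nat_poly :: "(nat \<Rightarrow> 'a::field_char_0) \<Rightarrow> bool" where
  "nat_poly f \<longleftrightarrow> (\<exists>p. \<forall>m. f m = poly p (of_nat m))"

lemma nat_poly_const [simp]: "nat_poly (\<lambda>m. c)"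
  unfolding nat_poly_def by (intro exI[of _ "[:c:]"]) simp

lemma nat_poly_of_nat [simp]: "nat_poly of_nat"
  unfolding nat_poly_def by (intro exI[of _ "[:0, 1:]"]) simp

lemma nat_poly_add: "nat_poly f \<Longrightarrow> nat_poly g \<Longrightarrow> nat_poly (\<lambda>m. f m + g m)"
  unfolding nat_poly_def by (metis poly_add)

lemma nat_poly_mult: "nat_poly f \<Longrightarrow> nat_poly g \<Longrightarrow> nat_poly (\<lambda>m. f m * g m)"
  unfolding nat_poly_def by (metis poly_mult)

lemma nat_poly_diff: "nat_poly f \<Longrightarrow> nat_poly g \<Longrightarrow> nat_poly (\<lambda>m. f m - g m)"
  unfolding nat_poly_def by (metis poly_diff)

lemma nat_poly_sum: "(\<And>i. i \<in> I \<Longrightarrow> nat_poly (f i)) \<Longrightarrow> nat_poly (\<lambda>m. \<Sum>i\<in>I. f i m)"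
  by (induction I rule: infinite_finite_induct) (auto intro: nat_poly_add)

lemma nat_poly_pochhammer: "nat_poly f \<Longrightarrow> nat_poly (\<lambda>m. pochhammer (f m) n)"
  by (induction n) (auto simp: pochhammer_Suc intro!: nat_poly_add nat_poly_mult)

text \<open>An antidifference of the polynomial behind \<open>g\<close> differs from
  \<open>f\<close> by a constant.\<close>

lemma nat_poly_recurrence:
  assumes "nat_poly g" "\<And>m. f (Suc m) = f m + g m"
  shows "nat_poly f"
proof -
  obtain q where q: "\<And>m. g m = poly q (of_nat m)" using assms(1) unfolding nat_poly_def by blast
  obtain p where p: "\<And>x. poly p (x + 1) - poly p x = poly q x" using poly_antidifference by blast
  have "f m = poly (p + [:f 0 - poly p 0:]) (of_nat m)" for m
  proof (induction m)
    case (Suc m)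
    then show ?case using p[of "of_nat m"] by (simp add: assms(2) q algebra_simps)
  qed simp
  then show ?thesis unfolding nat_poly_def by blast
qed

text \<open>In characteristic 0 the multiples of \<open>k\<close> are infinitely many distinct field
  elements, and a nonzero polynomial has only finitely many roots.\<close>

lemma nat_poly_eqI:
  assumes "nat_poly f" "nat_poly g" "k > 0" "\<And>n. f (k * n) = g (k * n)"
  shows "f = g"
proof -
  obtain p where p: "\<And>m. f m - g m = poly p (of_nat m)"
    using nat_poly_diff[OF assms(1,2)] unfolding nat_poly_def by blast
  have "range (\<lambda>n. of_nat (k * n)) \<subseteq> {x. poly p x = 0}"
    using p[of "k * _"] assms(4) by auto
  moreover have "inj (\<lambda>n. of_nat (k * n) :: 'a)"
    using assms(3) by (auto simp: inj_def of_nat_mult[symmetric] simp del: of_nat_mult)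
  then have "infinite (range (\<lambda>n. of_nat (k * n) :: 'a))"
    by (rule range_inj_infinite)
  ultimately have "p = 0"
    using poly_roots_finite finite_subset by blast
  then have "f m - g m = 0" for m using p[of m] by simp
  then show ?thesis by (intro ext) simp
qed

definition fps_nat_poly :: "(nat \<Rightarrow> 'a::field_char_0 fps) \<Rightarrow> bool" where
  "fps_nat_poly F \<longleftrightarrow> (\<forall>l. nat_poly (\<lambda>m. F m $ l))"

lemma fps_nat_poly_mult: "fps_nat_poly F \<Longrightarrow> fps_nat_poly (\<lambda>m. u * F m)"
  unfolding fps_nat_poly_def fps_mult_nth by (auto intro!: nat_poly_sum nat_poly_mult)

lemma fps_nat_poly_const [simp]: "fps_nat_poly (\<lambda>m. u)"
  by (simp add: fps_nat_poly_def)

lemma fps_nat_poly_add: "fps_nat_poly F \<Longrightarrow> fps_nat_poly G \<Longrightarrow> fps_nat_poly (\<lambda>m. F m + G m)"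
  by (simp add: fps_nat_poly_def nat_poly_add)

lemma fps_nat_poly_sum: "(\<And>i. i \<in> I \<Longrightarrow> fps_nat_poly (f i)) \<Longrightarrow> fps_nat_poly (\<lambda>m. \<Sum>i\<in>I. f i m)"
  by (induction I rule: infinite_finite_induct) (auto intro: fps_nat_poly_add)

lemma fps_nat_poly_nth_deriv: "fps_nat_poly F \<Longrightarrow> fps_nat_poly (\<lambda>m. fps_nth_deriv k (F m))"
proof (induction k)
  case (Suc k)
  then show ?case
    unfolding fps_nth_deriv_commute by (auto simp: fps_nat_poly_def intro!: nat_poly_mult)
qed simp

lemma fps_nat_poly_dpow_mult:
  "(\<And>k. k \<le> n \<Longrightarrow> fps_nat_poly (\<lambda>m. c m k)) \<Longrightarrow> fps_nat_poly (\<lambda>m. dpow_mult \<mu> (c m) n)"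
  unfolding dpow_mult_def
  by (intro fps_nat_poly_sum fps_nat_poly_mult fps_nat_poly_nth_deriv) auto

lemma nat_poly_delta_eval:
  "(\<And>k. k \<le> n \<Longrightarrow> fps_nat_poly (\<lambda>m. c m k)) \<Longrightarrow> nat_poly (\<lambda>m. delta_eval (of_nat m) (c m) n)"
  unfolding delta_eval_def fps_nat_poly_def
  by (intro nat_poly_sum nat_poly_mult nat_poly_pochhammer nat_poly_diff) auto

section \<open>Powers of a symbol of order 1\<close>

primrec symb_power :: "(nat \<Rightarrow> 'a::field_char_0 fps) \<Rightarrow> nat \<Rightarrow> nat \<Rightarrow> 'a fps" where
  "symb_power p 0 = symb_one"
| "symb_power p (Suc m) = symb_mult 1 p (symb_power p m)"

text \<open>Since \<open>p 0 = 1\<close>, one more factor \<open>p\<close> changes coefficient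
  \<open>n\<close> of the power by an increment \<open>g m\<close> that involves only coefficients
  of smaller index. These are polynomial in \<open>m\<close> by induction on \<open>n\<close>, hence
  so is their accumulated sum.\<close>

lemma fps_nat_poly_symb_power:
  assumes "p 0 = 1"
  shows "fps_nat_poly (\<lambda>m. symb_power p m n)"
proof (induction n rule: less_induct)
  case (less n)
  define g where "g m = (if n = 0 then 0 else fps_deriv (symb_power p m (n - 1)))
     + (\<Sum>i\<in>{1..n}. p i * dpow_mult (1 - of_nat i) (symb_power p m) (n - i))" for m
  have step: "symb_power p (Suc m) n = symb_power p m n + g m" for m
  proof -
    have "symb_power p (Suc m) n = p 0 * dpow_mult 1 (symb_power p m) n
      + (\<Sum>i\<in>{1..n}. p i * dpow_mult (1 - of_nat i) (symb_power p m) (n - i))"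
      by (simp add: symb_mult_def atMost_atLeast0 sum.atLeast_Suc_atMost)
    then show ?thesis by (simp add: assms g_def dpow_mult_one add.assoc)
  qed
  have "fps_nat_poly (\<lambda>m. fps_deriv (symb_power p m (n - 1)))" if "n \<noteq> 0"
    using fps_nat_poly_nth_deriv[of "\<lambda>m. symb_power p m (n - 1)" 1] less[of "n - 1"] that by simp
  then have "fps_nat_poly (\<lambda>m. if n = 0 then 0 else fps_deriv (symb_power p m (n - 1)))"
    by (cases "n = 0") simp_all
  moreover have "fps_nat_poly (\<lambda>m. symb_power p m k)" if "i \<in> {1..n}" "k \<le> n - i" for i k
    using that by (intro less) auto
  ultimately have "fps_nat_poly g"
    unfolding g_def by (intro fps_nat_poly_add fps_nat_poly_sum fps_nat_poly_mult fps_nat_poly_dpow_mult)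
  then have "nat_poly (\<lambda>m. g m $ l)" for l
    by (simp add: fps_nat_poly_def)
  then show ?case
    unfolding fps_nat_poly_def
    by (intro allI, rule nat_poly_recurrence) (simp add: step del: symb_power.simps)
qed

lemma symb_mult_3:
  "symb_mult 3 (symb_mult 1 p (symb_mult 1 q r)) s = symb_mult 1 p (symb_mult 1 q (symb_mult 1 r s))"
proof -
  have 1: "symb_mult (1 + 1) (symb_mult 1 q r) s = symb_mult 1 q (symb_mult 1 r s)"
    by (rule ext, rule symb_mult_assoc)
  have 2: "symb_mult (1 + 2) (symb_mult 1 p (symb_mult 1 q r)) s = symb_mult 1 p (symb_mult 2 (symb_mult 1 q r) s)"
    by (rule ext, rule symb_mult_assoc)
  show ?thesis using 1 2 by simp
qed

lemma symb_power_add_3: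
  assumes "symb_power p 3 = l"
  shows "symb_power p (m + 3) = symb_mult 3 l (symb_power p m)"
proof -
  have "l = symb_mult 1 p (symb_mult 1 p p)" using assms by (simp add: numeral_3_eq_3)
  then show ?thesis by (simp add: symb_mult_3 numeral_3_eq_3)
qed

text \<open>With \<open>symb_power_add_3\<close> this shows that the cube commutes with all powers,
  on which the commutator formula rests.\<close>

lemma symb_power_mult_3:
  assumes "symb_power p 3 = l"
  shows "symb_mult (of_nat m) (symb_power p m) l = symb_power p (m + 3)"
proof (induction m)
  case 0
  then show ?case by (simp add: assms)
next
  case (Suc m)
  have "symb_mult (of_nat (Suc m)) (symb_power p (Suc m)) l = symb_mult 1 p (symb_mult (of_nat m) (symb_power p m) l)"
    unfolding symb_power.simps of_nat_Suc by (rule ext, rule symb_mult_assoc)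
  then show ?case by (simp only: Suc add_Suc symb_power.simps)
qed

section \<open>The symbol built from the Hadamard coefficients\<close>

text \<open>\<open>fps_dx\<close>, \<open>fps_dt\<close> and \<open>fps_L\<close> are the
  counterparts of \<open>formal_dx\<close>, \<open>formal_dt\<close> and \<open>formal_L\<close>
  after Taylor expansion in x at a fixed y, with \<open>fps_X\<close> for x - y.\<close>

definition fps_dx :: "(int \<Rightarrow> nat \<Rightarrow> 'a::field_char_0 fps) \<Rightarrow> int \<Rightarrow> nat \<Rightarrow> 'a fps" where
  "fps_dx v n j = fps_deriv (v n j) +
     (if j = 0 then - (fps_const (1/3) * fps_X * v (n + 1) 1) else v n 0)"

definition fps_dt :: "(int \<Rightarrow> nat \<Rightarrow> 'a::field_char_0 fps) \<Rightarrow> int \<Rightarrow> nat \<Rightarrow> 'a fps" where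
  "fps_dt v n j =
     (if j = 0
      then fps_const (of_int (n + 1) - 1/3) * v (n + 1) 0 + fps_const (1/9) * fps_X\<^sup>2 * v (n + 2) 1
      else fps_const (of_int (n + 1) - 2/3) * v (n + 1) 1 - fps_const (1/3) * fps_X * v (n + 1) 0)"

definition fps_L :: "'a::field_char_0 fps \<Rightarrow> 'a fps \<Rightarrow> (int \<Rightarrow> nat \<Rightarrow> 'a fps) \<Rightarrow> int \<Rightarrow> nat \<Rightarrow> 'a fps" where
  "fps_L u0 u1 v n j = fps_dx (fps_dx (fps_dx v)) n j + u1 * fps_dx v n j + u0 * v n j"

definition third_fact :: "'a::field_char_0 \<Rightarrow> nat \<Rightarrow> 'a" where
  "third_fact \<beta> k = (\<Prod>i<k. \<beta> / 3 - of_nat i)"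

lemma third_fact_0 [simp]: "third_fact \<beta> 0 = 1"
  by (simp add: third_fact_def)

lemma third_fact_Suc: "third_fact \<beta> (Suc k) = third_fact \<beta> k * (\<beta> / 3 - of_nat k)"
  by (simp add: third_fact_def)

text \<open>Adding 3 to \<beta> puts one new factor in front of the product. This is the factor that
  both sides of the heat equation later share.\<close>

lemma third_fact_add_3: "third_fact (\<beta> + 3) (Suc k) = (\<beta> + 3) / 3 * third_fact \<beta> k"
  by (simp add: third_fact_def prod.lessThan_Suc_shift add_divide_distrib del: prod.lessThan_Suc)

text \<open>Read backwards, the product is a rising factorial. For \<beta> = 3k-2 and \<beta> = 3k-1
  its base is 1/3 and 2/3, which is where the constants of the flows come from.\<close>

lemma third_fact_eq_pochhammer: "third_fact \<beta> k = pochhammer (\<beta> / 3 - of_nat k + 1) k"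
proof -
  have "third_fact \<beta> k = (\<Prod>i<k. \<beta> / 3 - of_nat (k - Suc i))"
    unfolding third_fact_def by (rule prod.nat_diff_reindex[symmetric])
  also have "\<dots> = pochhammer (\<beta> / 3 - of_nat k + 1) k"
    unfolding pochhammer_prod atLeast0LessThan
    by (rule prod.cong) (auto simp: of_nat_diff)
  finally show ?thesis .
qed

text \<open>
  \<open>hadamard_symb \<beta> v\<close> has order \<open>\<beta>\<close> and applied to the delta function gives \<open>S\<^sub>\<beta>\<close>. The operations
  \<open>fps_dx\<close> and \<open>fps_dt\<close> also produce terms with index \<open>n = - 1\<close>, for which the falling factorial at
  \<open>\<beta> - 3\<close> has to be replaced by a multiple of the one at \<open>\<beta>\<close>: \<open>shifted_symb \<beta> w\<close> has order \<open>\<beta> + 1\<close>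
  and carries \<open>w (n - 1) j\<close> at \<open>e\<^sub>\<beta>\<^sub>-\<^sub>3\<^sub>n\<^sub>+\<^sub>j\<close>.
\<close>

definition hadamard_symb :: "'a::field_char_0 \<Rightarrow> (int \<Rightarrow> nat \<Rightarrow> 'a fps) \<Rightarrow> nat \<Rightarrow> 'a fps" where
  "hadamard_symb \<beta> v i =
     (if i mod 3 = 0 then fps_const (third_fact \<beta> (i div 3)) * v (int (i div 3)) 0
      else if i mod 3 = 2 then fps_const (third_fact \<beta> (Suc (i div 3))) * v (int (Suc (i div 3))) 1
      else 0)"

definition shifted_symb :: "'a::field_char_0 \<Rightarrow> (int \<Rightarrow> nat \<Rightarrow> 'a fps) \<Rightarrow> nat \<Rightarrow> 'a fps" where
  "shifted_symb \<beta> w i =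
     (if i mod 3 = 0 then fps_const (third_fact \<beta> (i div 3)) * w (int (i div 3) - 1) 1
      else if i mod 3 = 1 then fps_const (third_fact \<beta> (i div 3)) * w (int (i div 3) - 1) 0
      else 0)"

section \<open>Coefficients of the two symbols by residue modulo 3\<close>

lemma nat_mod_3_cases:
  obtains k where "i = 3 * k" | k where "i = Suc (3 * k)" | k where "i = Suc (Suc (3 * k))"
proof -
  have "i mod 3 = 0 \<or> i mod 3 = 1 \<or> i mod 3 = 2" by presburger
  then show ?thesis using that div_mult_mod_eq[of i 3]
    by (metis Suc_1 Suc_eq_plus1 add.right_neutral add_Suc_right mult.commute)
qed

lemma div_3_Suc: "Suc (Suc (Suc (Suc (3 * k)))) div 3 = Suc k" "Suc (3 * k) div 3 = k" "Suc (Suc (3 * k)) div 3 = k" "Suc (Suc (Suc (3 * k))) div 3 = Suc k"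
    "3 * k div 3 = (k::nat)"
  by presburger+

lemma mod_3_Suc: "Suc (Suc (Suc (Suc (3 * k)))) mod 3 = 1" "Suc (3 * k) mod 3 = 1" "Suc (Suc (3 * k)) mod 3 = 2" "Suc (Suc (Suc (3 * k))) mod 3 = 0"
    "3 * k mod 3 = (0::nat)"
  by presburger+

lemma shifted_symb_simps:
  "shifted_symb \<beta> w (3 * k) = fps_const (third_fact \<beta> k) * w (int k - 1) 1"
  "shifted_symb \<beta> w (Suc (3 * k)) = fps_const (third_fact \<beta> k) * w (int k - 1) 0"
  "shifted_symb \<beta> w (Suc (Suc (3 * k))) = 0"
  "shifted_symb \<beta> w (Suc (Suc (Suc (3 * k)))) = fps_const (third_fact \<beta> (Suc k)) * w (int k) 1"
  "shifted_symb \<beta> w (Suc (Suc (Suc (Suc (3 * k))))) = fps_const (third_fact \<beta> (Suc k)) * w (int k) 0"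
  by (simp_all add: shifted_symb_def div_3_Suc mod_3_Suc)

lemma hadamard_symb_simps:
  "hadamard_symb \<beta> v (3 * k) = fps_const (third_fact \<beta> k) * v (int k) 0"
  "hadamard_symb \<beta> v (Suc (3 * k)) = 0"
  "hadamard_symb \<beta> v (Suc (Suc (3 * k))) = fps_const (third_fact \<beta> (Suc k)) * v (int k + 1) 1"
  by (simp_all add: hadamard_symb_def div_3_Suc mod_3_Suc add.commute)

text \<open>Evaluation kills every combination of the relations of
  \<open>delta_eval_fps_X_relation\<close>, so two symbols may be compared by exhibiting multipliers
  \<open>f\<close>.\<close>

lemma delta_eval_eqI:
  assumes "\<And>i. r i = s i + (fps_X * f i + (if i = 0 then 0 else fps_const (\<gamma> - of_nat (i - 1)) * f (i - 1)))"
  shows "delta_eval \<gamma> r n = delta_eval \<gamma> s n"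
  using delta_eval_add[of \<gamma> s "\<lambda>i. fps_X * f i + (if i = 0 then 0 else fps_const (\<gamma> - of_nat (i - 1)) * f (i - 1))" n]
  by (simp add: delta_eval_fps_X_relation assms[abs_def])

text \<open>The formal x-derivative becomes the true derivation on the symbols. The Airy term with
  factor -z/3 agrees with the relation \<open>z e\<^sub>i = - i e\<^sub>i\<^sub>-\<^sub>1\<close>
  because consecutive values of \<open>third_fact\<close> differ by the factor \<beta>/3 -
  k.\<close>

lemma delta_eval_shifted_symb_fps_dx:
  assumes "w (- 1) 1 = 0"
  shows "delta_eval (\<beta> + 1) (shifted_symb \<beta> (fps_dx w)) n = delta_eval (\<beta> + 1) (shifted_symb \<beta> w) (Suc n)"
proof -
  let ?q = "shifted_symb \<beta> w"
  \<comment> \<open>Only the component j = 0, found at the indices 3k+1, contains a factor z to be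
    reduced.\<close>
  define f where "f i = (if i mod 3 = 1 then - (fps_const (third_fact \<beta> (i div 3) / 3) * w (int (i div 3)) 1) else 0)" for i :: nat
  have f: "f (3 * k) = 0" "f (Suc (3 * k)) = - (fps_const (third_fact \<beta> k / 3) * w (int k) 1)"
    "f (Suc (Suc (3 * k))) = 0" "f (Suc (Suc (Suc (3 * k)))) = 0" for k
    by (simp_all add: f_def div_3_Suc mod_3_Suc)
  have q0: "?q 0 = 0" using assms by (simp add: shifted_symb_def)
  have "delta_eval (\<beta> + 1) (shifted_symb \<beta> (fps_dx w)) n = delta_eval (\<beta> + 1) (dpow_mult 1 (\<lambda>i. ?q (Suc i))) n"
  proof (rule delta_eval_eqI[where f = f])
    fix i
    show "shifted_symb \<beta> (fps_dx w) i = dpow_mult 1 (\<lambda>i. ?q (Suc i)) i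
      + (fps_X * f i + (if i = 0 then 0 else fps_const (\<beta> + 1 - of_nat (i - 1)) * f (i - 1)))"
    proof (cases i rule: nat_mod_3_cases)
      case (1 k)
      show ?thesis
      proof (cases k)
        case 0
        then show ?thesis using 1 assms f(1)[of 0]
          by (simp add: dpow_mult_one shifted_symb_simps(1)[of _ _ 0, simplified] shifted_symb_simps(2)[of _ _ 0, simplified]
              fps_dx_def)
      next
        case (Suc l)
        have i: "i = Suc (Suc (Suc (3 * l)))" using 1 Suc by simp
        show ?thesis unfolding i
          by (simp add: dpow_mult_one shifted_symb_simps f fps_dx_def distrib_left)
      qed
    next
      case (2 k)
      have 1: "fps_const (third_fact \<beta> k / 3) = fps_const (third_fact \<beta> k) * fps_const (1 / 3)"
        by simp
      show ?thesis unfolding 2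
        apply (simp only: dpow_mult_one shifted_symb_simps f fps_dx_def diff_Suc_Suc minus_nat.diff_0 nat.distinct if_False if_True
          One_nat_def fps_deriv_mult_const_left)
        apply (simp add: int_ops)
        using 1 by algebra
    next
      case (3 k)
      have "third_fact \<beta> (Suc k) = (\<beta> + 1 - of_nat (Suc (3 * k))) * (third_fact \<beta> k / 3)"
        by (simp add: third_fact_Suc field_simps)
      then show ?thesis unfolding 3 dpow_mult_one
        by (simp add: shifted_symb_simps f mult.assoc[symmetric])
    qed
  qed
  also have "\<dots> = delta_eval \<beta> (\<lambda>i. ?q (Suc i)) n"
    by (rule delta_eval_dpow_mult_one)
  \<comment> \<open>Order \<beta> is rewritten as order \<beta>+1 with one more place in front;
    nothing is lost there as \<open>?q 0\<close> vanishes.\<close>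
  also have "\<dots> = delta_eval (\<beta> + 1) (\<lambda>i. if 1 \<le> i then ?q (Suc (i - 1)) else 0) (Suc n)"
    by (subst delta_eval_shift[where r = "\<lambda>i. ?q (Suc i)"]) simp
  also have "(\<lambda>i. if 1 \<le> i then ?q (Suc (i - 1)) else 0) = ?q"
    using q0 by (auto simp: fun_eq_iff not_less_eq_eq le_Suc_eq)
  finally show ?thesis .
qed

text \<open>Once z and z^2 are reduced, the terms of the formal t-derivative combine to a plain
  multiplication by \<beta>/3.\<close>

lemma delta_eval_shifted_symb_fps_dt:
  assumes "v 0 1 = 0"
  shows "delta_eval (\<beta> + 1) (shifted_symb \<beta> (fps_dt v)) n =
    delta_eval (\<beta> + 1) (\<lambda>i. if 1 \<le> i then fps_const (\<beta> / 3) * hadamard_symb \<beta> v (i - 1) else 0) n"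
proof (rule delta_eval_eqI)
  \<comment> \<open>The multipliers at 3k reduce the term with z of the component j = 1; those at
    3k+1 lower z^2 to z in the component j = 0, and those at 3k+2 remove the remaining z.\<close>
  let ?f = "\<lambda>i. if i mod 3 = 0 then - (fps_const (third_fact \<beta> (i div 3) / 3) * v (int (i div 3)) 0)
    else if i mod 3 = 1 then fps_const (third_fact \<beta> (i div 3) / 9) * fps_X * v (int (i div 3) + 1) 1
    else - (fps_const (third_fact \<beta> (Suc (i div 3)) / 3) * v (int (i div 3) + 1) 1)"
  define f where "f = ?f"
  have f: "f (3 * k) = - (fps_const (third_fact \<beta> k / 3) * v (int k) 0)"
    "f (Suc (3 * k)) = fps_const (third_fact \<beta> k / 9) * fps_X * v (int k + 1) 1"
    "f (Suc (Suc (3 * k))) = - (fps_const (third_fact \<beta> (Suc k) / 3) * v (int k + 1) 1)"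
    "f (Suc (Suc (Suc (3 * k)))) = - (fps_const (third_fact \<beta> (Suc k) / 3) * v (int k + 1) 0)" for k
    by (simp_all add: f_def div_3_Suc mod_3_Suc add.commute)
  fix i
  have "shifted_symb \<beta> (fps_dt v) i = (if 1 \<le> i then fps_const (\<beta> / 3) * hadamard_symb \<beta> v (i - 1) else 0)
      + (fps_X * f i + (if i = 0 then 0 else fps_const (\<beta> + 1 - of_nat (i - 1)) * f (i - 1)))"
  proof (cases i rule: nat_mod_3_cases)
    case (1 k)
    show ?thesis
    proof (cases k)
      case 0
      then show ?thesis using 1 assms f(1)[of 0]
        by (simp add: shifted_symb_simps(1)[of _ _ 0, simplified] fps_dt_def algebra_simps)
    next
      case (Suc l)
      have i: "i = Suc (Suc (Suc (3 * l)))" using 1 Suc by simp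
      have "third_fact \<beta> (Suc l) * (of_nat (Suc l) - 2/3) =
          \<beta> / 3 * third_fact \<beta> (Suc l) - (\<beta> + 1 - of_nat (Suc (Suc (3 * l)))) * (third_fact \<beta> (Suc l) / 3)"
        by (simp add: field_simps)
      from arg_cong[OF this, of fps_const]
      have 1: "fps_const (third_fact \<beta> (Suc l)) * fps_const (of_nat (Suc l) - 2/3) =
          fps_const (\<beta> / 3) * fps_const (third_fact \<beta> (Suc l)) -
           fps_const (\<beta> + 1 - of_nat (Suc (Suc (3 * l)))) * fps_const (third_fact \<beta> (Suc l) / 3)"
        by simp
      have 2: "fps_const (third_fact \<beta> (Suc l)) * fps_const (1/3) = fps_const (third_fact \<beta> (Suc l) / 3)"
        by simp
      have 3: "of_int (int l + 1) = (of_nat (Suc l) :: 'a)" by simp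
      show ?thesis unfolding i
        apply (simp only: shifted_symb_simps hadamard_symb_simps f fps_dt_def diff_Suc_Suc minus_nat.diff_0 nat.distinct if_False if_True
            Suc_le_mono One_nat_def le0 3 one_neq_zero)
        using 1 2 by algebra
    qed
  next
    case (2 k)
    have 3: "of_int (int k - 1 + 1) = (of_nat k :: 'a)" "int k - 1 + 1 = int k" "int k - 1 + 2 = int k + 1" by simp_all
    have "third_fact \<beta> k * (of_nat k - 1/3) =
          \<beta> / 3 * third_fact \<beta> k - (\<beta> + 1 - of_nat (3 * k)) * (third_fact \<beta> k / 3)"
      by (simp add: field_simps)
    from arg_cong[OF this, of fps_const]
    have 1: "fps_const (third_fact \<beta> k) * fps_const (of_nat k - 1/3) =
          fps_const (\<beta> / 3) * fps_const (third_fact \<beta> k) -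
           fps_const (\<beta> + 1 - of_nat (3 * k)) * fps_const (third_fact \<beta> k / 3)"
      by simp
    have 2: "fps_const (third_fact \<beta> k) * fps_const (1/9) = fps_const (third_fact \<beta> k / 9)"
      by simp
    show ?thesis unfolding \<open>i = _\<close>
      apply (simp only: shifted_symb_simps hadamard_symb_simps f fps_dt_def diff_Suc_Suc minus_nat.diff_0 nat.distinct if_False if_True
          Suc_le_mono One_nat_def le0 3 power2_eq_square refl of_int_of_nat_eq)
      using 1 2 by algebra
  next
    case (3 k)
    have "third_fact \<beta> (Suc k) / 3 = (\<beta> + 1 - of_nat (Suc (3 * k))) * (third_fact \<beta> k / 9)"
      by (simp add: third_fact_Suc field_simps)
    from arg_cong[OF this, of fps_const]
    have 1: "fps_const (third_fact \<beta> (Suc k) / 3) = fps_const (\<beta> + 1 - of_nat (Suc (3 * k))) * fps_const (third_fact \<beta> k / 9)"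
      by simp
    show ?thesis unfolding \<open>i = _\<close>
      apply (simp only: shifted_symb_simps hadamard_symb_simps f fps_dt_def diff_Suc_Suc minus_nat.diff_0 nat.distinct if_False if_True
          Suc_le_mono One_nat_def le0)
      using 1 by algebra
  qed
  then show "shifted_symb \<beta> (fps_dt v) i = (if 1 \<le> i then fps_const (\<beta> / 3) * hadamard_symb \<beta> v (i - 1) else 0)
      + (fps_X * ?f i + (if i = 0 then 0 else fps_const (\<beta> + 1 - of_nat (i - 1)) * ?f (i - 1)))"
    by (simp only: f_def)
qed

text \<open>The orders are \<alpha>+4 and \<alpha>, whence the shift by 4, and the constant is that
  of \<open>third_fact_add_3\<close>. The hypotheses clear the four leading places.\<close>

lemma shifted_symb_eq_hadamard_symb:
  assumes "\<And>j. v (- 1) j = 0" "v 0 1 = 0"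
  shows "shifted_symb (\<alpha> + 3) v i = (if 4 \<le> i then fps_const ((\<alpha> + 3) / 3) * hadamard_symb \<alpha> v (i - 4) else 0)"
proof (cases "4 \<le> i")
  case True
  then obtain l where i: "i = l + 4" by (metis le_add_diff_inverse2)
  show ?thesis
  proof (cases l rule: nat_mod_3_cases)
    case (1 k)
    then have "i = Suc (Suc (Suc (Suc (3 * k))))" using i by simp
    then show ?thesis using 1 i by (simp only: shifted_symb_simps hadamard_symb_simps third_fact_add_3) (simp add: hadamard_symb_simps)
  next
    case (2 k)
    then have "i = Suc (Suc (3 * Suc k))" using i by simp
    then show ?thesis using 2 i by (simp only: shifted_symb_simps) (simp add: hadamard_symb_simps)
  next
    case (3 k)
    then have "i = 3 * Suc (Suc k)" using i by simp
    then have "shifted_symb (\<alpha> + 3) v i = fps_const (third_fact (\<alpha> + 3) (Suc (Suc k))) * v (int (Suc (Suc k)) - 1) 1"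
      by (simp only: shifted_symb_simps)
    moreover have "int (Suc (Suc k)) - 1 = int k + 1" by simp
    ultimately show ?thesis using 3 i
      by (simp only: third_fact_add_3) (simp add: hadamard_symb_simps)
  qed
next
  case False
  then have "i \<in> {0, 1, 2, 3}" by auto
  then show ?thesis
    using assms shifted_symb_simps[of "\<alpha> + 3" v 0] by (auto simp: eval_nat_numeral)
qed

lemma hadamard_symb_zero:
  assumes "v 0 0 = 1" "v 0 1 = 0"
  shows "hadamard_symb 0 v = symb_one"
proof
  fix i
  have "third_fact 0 (Suc k) = (0::'a)" for k
    by (simp add: third_fact_def prod.lessThan_Suc_shift del: prod.lessThan_Suc)
  then show "hadamard_symb 0 v i = symb_one i"
    by (cases i rule: nat_mod_3_cases, case_tac [!] k)
       (auto simp: hadamard_symb_simps symb_one_def assms hadamard_symb_def)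
qed

text \<open>This is \<open>L S\<^sub>\<alpha> = S\<^sub>\<alpha>\<^sub>+\<^sub>3\<close>. Encoding
  the heat equation by \<open>shifted_symb (\<alpha> + 3)\<close> yields (\<alpha>+3)/3 times
  \<open>S\<^sub>\<alpha>\<^sub>+\<^sub>3\<close> from the t-derivative and the same constant times
  \<open>L S\<^sub>\<alpha>\<close> from the other side; the constant is cancelled at the
  end.\<close>

lemma delta_eval_hadamard_symb_step:
  fixes v :: "int \<Rightarrow> nat \<Rightarrow> 'a::field_char_0 fps"
  assumes heat: "\<And>n j. j \<in> {0, 1} \<Longrightarrow> fps_dt v n j = fps_L u0 u1 v n j"
    and neg: "\<And>n j. n < 0 \<Longrightarrow> v n j = 0" and v01: "v 0 1 = 0"
    and \<alpha>: "\<alpha> + 3 \<noteq> 0"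
  shows "delta_eval (\<alpha> + 3) (symb_mult 3 (L_symb u0 u1) (hadamard_symb \<alpha> v)) =
    delta_eval (\<alpha> + 3) (hadamard_symb (\<alpha> + 3) v)"
proof
  fix n
  define c where "c = (\<alpha> + 3) / 3"
  define h where "h = hadamard_symb \<alpha> v"
  define E where "E w = delta_eval (\<alpha> + 3 + 1) (shifted_symb (\<alpha> + 3) w)" for w
  have shift4: "shifted_symb (\<alpha> + 3) v = (\<lambda>i. if 4 \<le> i then fps_const c * h (i - 4) else 0)"
    using shifted_symb_eq_hadamard_symb[of v \<alpha>] neg v01 by (simp add: fun_eq_iff c_def h_def)
  have Edx: "E (fps_dx w) k = E w (Suc k)" if "w (- 1) 1 = 0" for w k
    unfolding E_def using that by (rule delta_eval_shifted_symb_fps_dx)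
  \<comment> \<open>The Airy term of \<open>fps_dx\<close> brings index 0 down to -1, so the second
    equation also relies on \<open>v 0 1 = 0\<close>.\<close>
  have dx1: "fps_dx v (- 1) 1 = 0" and dx2: "fps_dx (fps_dx v) (- 1) 1 = 0"
    by (simp_all add: fps_dx_def neg v01[unfolded One_nat_def])
  have Ev: "E v k = (if 4 \<le> k then c * delta_eval \<alpha> h (k - 4) else 0)" for k
    unfolding E_def shift4 delta_eval_shift[where r = "\<lambda>i. fps_const c * h i"]
    by (simp add: delta_eval_const_mult add.commute)
  \<comment> \<open>Three derivations move index n+1 to n+4, and the shift by 4 in \<open>Ev\<close>
    brings it back to n.\<close>
  have E3: "E (fps_dx (fps_dx (fps_dx v))) (Suc n) = c * delta_eval \<alpha> h n"
    using Edx[of "fps_dx (fps_dx v)" "Suc n", OF dx2] Edx[of "fps_dx v" "Suc (Suc n)", OF dx1]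
      Edx[of v "Suc (Suc (Suc n))"]
    by (simp add: neg Ev)
  have u1: "delta_eval (\<alpha> + 3 + 1) (\<lambda>i. u1 * shifted_symb (\<alpha> + 3) (fps_dx v) i) (Suc n) =
    c * (if 2 \<le> n then delta_eval (\<alpha> + 1) (\<lambda>i. u1 * dpow_mult 1 h i) (n - 2) else 0)"
  proof -
    have "delta_eval (\<alpha> + 3 + 1) (\<lambda>i. u1 * shifted_symb (\<alpha> + 3) (fps_dx v) i) (Suc n) =
      delta_eval (\<alpha> + 3 + 1) (\<lambda>i. u1 * (if 3 \<le> i then fps_const c * dpow_mult 1 h (i - 3) else 0)) (Suc n)"
    \<comment> \<open>Before the factor \<open>u1\<close> is attached, the formal derivative may be
      exchanged for the derivation of \<open>h\<close>, as their evaluations agree.\<close>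
    proof (rule delta_eval_mult_cong)
      fix k
      have "delta_eval (\<alpha> + 3 + 1) (shifted_symb (\<alpha> + 3) (fps_dx v)) k = E v (Suc k)"
        using Edx[of v k] by (simp add: neg E_def)
      also have "\<dots> = delta_eval (\<alpha> + 3 + 1) (\<lambda>i. if 3 \<le> i then fps_const c * dpow_mult 1 h (i - 3) else 0) k"
        unfolding Ev delta_eval_shift[where r = "\<lambda>i. fps_const c * dpow_mult 1 h i"]
        using delta_eval_dpow_mult_one[of \<alpha> h "k - 3"]
        by (auto simp: delta_eval_const_mult add.commute)
      finally show "delta_eval (\<alpha> + 3 + 1) (shifted_symb (\<alpha> + 3) (fps_dx v)) k =
         delta_eval (\<alpha> + 3 + 1) (\<lambda>i. if 3 \<le> i then fps_const c * dpow_mult 1 h (i - 3) else 0) k" .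
    qed
    also have "(\<lambda>i. u1 * (if 3 \<le> i then fps_const c * dpow_mult 1 h (i - 3) else 0)) =
       (\<lambda>i. if 3 \<le> i then fps_const c * (u1 * dpow_mult 1 h (i - 3)) else 0)"
      by (auto simp: mult.left_commute)
    finally show ?thesis
      unfolding delta_eval_shift[where r = "\<lambda>i. fps_const c * (u1 * dpow_mult 1 h i)"]
      by (auto simp: delta_eval_const_mult add.commute)
  qed
  have u0: "delta_eval (\<alpha> + 3 + 1) (\<lambda>i. u0 * shifted_symb (\<alpha> + 3) v i) (Suc n) =
    c * (if 3 \<le> n then delta_eval \<alpha> (\<lambda>i. u0 * h i) (n - 3) else 0)"
  proof -
    have "(\<lambda>i. u0 * shifted_symb (\<alpha> + 3) v i) = (\<lambda>i. if 4 \<le> i then fps_const c * (u0 * h (i - 4)) else 0)"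
      unfolding shift4 by (auto simp: mult.left_commute)
    then show ?thesis
      unfolding delta_eval_shift[where r = "\<lambda>i. fps_const c * (u0 * h i)"]
      by (auto simp: delta_eval_const_mult add.commute delta_eval_shift[where r = "\<lambda>i. fps_const c * (u0 * h i)"])
  qed
  have "shifted_symb (\<alpha> + 3) (fps_dt v) = shifted_symb (\<alpha> + 3) (fps_L u0 u1 v)"
    by (rule ext) (simp add: shifted_symb_def heat)
  also have "\<dots> = (\<lambda>i. shifted_symb (\<alpha> + 3) (fps_dx (fps_dx (fps_dx v))) i
     + u1 * shifted_symb (\<alpha> + 3) (fps_dx v) i + u0 * shifted_symb (\<alpha> + 3) v i)"
    by (rule ext) (simp add: shifted_symb_def fps_L_def distrib_left mult.left_commute)
  finally have "delta_eval (\<alpha> + 3 + 1) (shifted_symb (\<alpha> + 3) (fps_dt v)) (Suc n) =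
     c * delta_eval (\<alpha> + 3) (symb_mult 3 (L_symb u0 u1) h) n"
    by (simp only: delta_eval_add u0 u1 E3[unfolded E_def] delta_eval_symb_mult_L_symb distrib_left)
  moreover have "delta_eval (\<alpha> + 3 + 1) (shifted_symb (\<alpha> + 3) (fps_dt v)) (Suc n) =
     c * delta_eval (\<alpha> + 3) (hadamard_symb (\<alpha> + 3) v) n"
    unfolding delta_eval_shifted_symb_fps_dt[of v, OF v01]
      delta_eval_shift[where r = "\<lambda>i. fps_const ((\<alpha> + 3) / 3) * hadamard_symb (\<alpha> + 3) v i"]
    by (simp add: delta_eval_const_mult c_def add.commute)
  ultimately show "delta_eval (\<alpha> + 3) (symb_mult 3 (L_symb u0 u1) (hadamard_symb \<alpha> v)) n =
    delta_eval (\<alpha> + 3) (hadamard_symb (\<alpha> + 3) v) n"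
    using \<alpha> by (simp add: c_def h_def)
qed

text \<open>At multiples of 3 both sides start from the delta function and advance by the action of
  L. Both depend polynomially on \<open>m\<close>, so agreement there extends to all
  \<open>m\<close>.\<close>

lemma delta_eval_symb_power_eq_hadamard_symb:
  fixes v :: "int \<Rightarrow> nat \<Rightarrow> 'a::field_char_0 fps"
  assumes heat: "\<And>n j. j \<in> {0, 1} \<Longrightarrow> fps_dt v n j = fps_L u0 u1 v n j"
    and neg: "\<And>n j. n < 0 \<Longrightarrow> v n j = 0" and v0: "v 0 0 = 1" "v 0 1 = 0"
    and p0: "p 0 = 1" and p3: "symb_power p 3 = L_symb u0 u1"
  shows "delta_eval (of_nat m) (symb_power p m) n = delta_eval (of_nat m) (hadamard_symb (of_nat m) v) n"
proof -
  have triple: "delta_eval (of_nat (3 * k)) (symb_power p (3 * k)) = delta_eval (of_nat (3 * k)) (hadamard_symb (of_nat (3 * k)) v)" for k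
  proof (induction k)
    case 0
    then show ?case by (simp add: hadamard_symb_zero[of v, OF v0])
  next
    case (Suc k)
    have *: "of_nat (3 * Suc k) = of_nat (3 * k) + (3 :: 'a)" "3 * Suc k = 3 * k + 3" by simp_all
    have nz: "of_nat (3 * k) + (3 :: 'a) \<noteq> 0"
      unfolding *(1)[symmetric] of_nat_eq_0_iff by simp
    show ?case
      unfolding *(1) unfolding *(2) symb_power_add_3[OF p3]
      using delta_eval_symb_mult_L_symb_cong[OF Suc] delta_eval_hadamard_symb_step[OF heat neg v0(2) nz]
      by simp
  qed
  have "nat_poly (\<lambda>m. delta_eval (of_nat m) (symb_power p m) n)"
    by (rule nat_poly_delta_eval) (rule fps_nat_poly_symb_power[of p, OF p0])
  moreover have third: "nat_poly (\<lambda>m. third_fact (of_nat m :: 'a) k)" for k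
  proof (induction k)
    case (Suc k)
    have "nat_poly (\<lambda>m. of_nat m * (1 / 3 :: 'a) - of_nat k)"
      by (intro nat_poly_diff nat_poly_mult) auto
    with Suc show ?case by (auto simp: third_fact_Suc intro: nat_poly_mult)
  qed simp
  then have "fps_nat_poly (\<lambda>m. hadamard_symb (of_nat m) v i)" for i
    by (cases "i mod 3 = 0"; cases "i mod 3 = 2")
       (auto simp: hadamard_symb_def fps_nat_poly_def intro!: nat_poly_mult)
  then have "nat_poly (\<lambda>m. delta_eval (of_nat m) (hadamard_symb (of_nat m) v) n)"
    by (intro nat_poly_delta_eval)
  ultimately have "(\<lambda>m. delta_eval (of_nat m) (symb_power p m) n) =
     (\<lambda>m. delta_eval (of_nat m) (hadamard_symb (of_nat m) v) n)"
    by (rule nat_poly_eqI[where k = 3]) (simp_all only: triple)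
  then show ?thesis by (rule fun_cong)
qed

section \<open>Jets of smooth functions\<close>

lemma eventually_nhds_openI: "open A \<Longrightarrow> x \<in> A \<Longrightarrow> (\<And>z. z \<in> A \<Longrightarrow> Q z) \<Longrightarrow> eventually Q (nhds x)"
  unfolding eventually_nhds by blast

lemma Dx_cong_nhds:
  assumes "eventually (\<lambda>z. f z = g z) (nhds x)"
  shows "Dx f x = Dx g x"
  unfolding Dx_def by (rule vector_derivative_cong_eq) (use assms in \<open>auto elim: eventually_mono\<close>)

text \<open>Equality near a point holds near all neighbouring points as well, and so survives each
  differentiation.\<close>

lemma funpow_Dx_cong_nhds:
  assumes "eventually (\<lambda>z. f z = g z) (nhds x)"
  shows "eventually (\<lambda>z. (Dx ^^ i) f z = (Dx ^^ i) g z) (nhds x)"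
proof (induction i)
  case (Suc i)
  from Suc.IH have "eventually (\<lambda>z. eventually (\<lambda>z. (Dx ^^ i) f z = (Dx ^^ i) g z) (nhds z)) (nhds x)"
    by (simp add: eventually_eventually)
  then show ?case by eventually_elim (simp add: Dx_cong_nhds)
qed (simp add: assms)

section \<open>Smoothness near a point and Taylor series\<close>

definition ndiff_on :: "nat \<Rightarrow> real set \<Rightarrow> (real \<Rightarrow> 'a::real_normed_field) \<Rightarrow> bool" where
  "ndiff_on n A f \<longleftrightarrow> (\<forall>i<n. \<forall>z\<in>A. (Dx ^^ i) f differentiable at z)"

text \<open>One neighbourhood serves all orders, so that smoothness passes to nearby points and to
  derivatives.\<close>

definition smooth_at :: "real \<Rightarrow> (real \<Rightarrow> 'a::real_normed_field) \<Rightarrow> bool" where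
  "smooth_at x f \<longleftrightarrow> (\<exists>A. open A \<and> x \<in> A \<and> (\<forall>n. ndiff_on n A f))"

definition jet :: "real \<Rightarrow> (real \<Rightarrow> 'a::real_normed_field) \<Rightarrow> 'a fps" where
  "jet x f = Abs_fps (\<lambda>i. (Dx ^^ i) f x / fact i)"

lemma jet_nth: "jet x f $ i = (Dx ^^ i) f x / fact i"
  by (simp add: jet_def)

lemma jet_cong:
  assumes "eventually (\<lambda>z. f z = g z) (nhds x)"
  shows "jet x f = jet x g"
  by (rule fps_ext) (simp add: jet_nth eventually_nhds_x_imp_x[OF funpow_Dx_cong_nhds[OF assms]])

lemma differentiable_cong_nhds:
  assumes "eventually (\<lambda>z. f z = g z) (nhds x)" "f differentiable at x"
  shows "g differentiable at x"
proof -
  obtain A where A: "open A" "x \<in> A" "\<And>z. z \<in> A \<Longrightarrow> f z = g z"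
    using assms(1) unfolding eventually_nhds by blast
  obtain D where "(f has_derivative D) (at x)"
    using assms(2) unfolding differentiable_def by blast
  then have "(g has_derivative D) (at x)"
    by (rule has_derivative_transform_within_open) (use A in auto)
  then show ?thesis unfolding differentiable_def by blast
qed

lemma ndiff_on_0 [simp]: "ndiff_on 0 A f"
  by (simp add: ndiff_on_def)

lemma ndiff_on_Suc: "ndiff_on (Suc n) A f \<longleftrightarrow> (\<forall>z\<in>A. f differentiable at z) \<and> ndiff_on n A (Dx f)"
  by (auto simp: ndiff_on_def less_Suc_eq_0_disj funpow_Suc_right simp del: funpow.simps)

lemma ndiff_on_mono: "ndiff_on n A f \<Longrightarrow> m \<le> n \<Longrightarrow> B \<subseteq> A \<Longrightarrow> ndiff_on m B f"
  by (auto simp: ndiff_on_def)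

lemma ndiff_on_cong:
  assumes "open A" "\<And>z. z \<in> A \<Longrightarrow> f z = g z" "ndiff_on n A f"
  shows "ndiff_on n A g"
  unfolding ndiff_on_def
proof (intro allI impI ballI)
  fix i z assume "i < n" "z \<in> A"
  then show "(Dx ^^ i) g differentiable at z"
    using assms differentiable_cong_nhds[OF funpow_Dx_cong_nhds[OF eventually_nhds_openI[of A z "\<lambda>z. f z = g z"]]]
    by (auto simp: ndiff_on_def)
qed

lemma smooth_at_obtain2:
  assumes "smooth_at x f" "smooth_at x g"
  obtains A where "open A" "x \<in> A" "\<And>n. ndiff_on n A f" "\<And>n. ndiff_on n A g"
proof -
  obtain A where A: "open A" "x \<in> A" "\<And>n. ndiff_on n A f"
    using assms(1) unfolding smooth_at_def by blast
  obtain B where B: "open B" "x \<in> B" "\<And>n. ndiff_on n B g"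
    using assms(2) unfolding smooth_at_def by blast
  have "ndiff_on n (A \<inter> B) f" "ndiff_on n (A \<inter> B) g" for n
    using ndiff_on_mono[OF A(3)[of n]] ndiff_on_mono[OF B(3)[of n]] by auto
  then show ?thesis using that[of "A \<inter> B"] A B by auto
qed

lemma smooth_at_cong:
  assumes "eventually (\<lambda>z. f z = g z) (nhds x)" "smooth_at x f"
  shows "smooth_at x g"
proof -
  obtain A where A: "open A" "x \<in> A" "\<And>n. ndiff_on n A f"
    using assms(2) unfolding smooth_at_def by blast
  obtain B where B: "open B" "x \<in> B" "\<And>z. z \<in> B \<Longrightarrow> f z = g z"
    using assms(1) unfolding eventually_nhds by blast
  have "ndiff_on n (A \<inter> B) g" for n
    by (rule ndiff_on_cong[of _ f]) (use A B ndiff_on_mono[of n A f n "A \<inter> B"] in auto)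
  then show ?thesis unfolding smooth_at_def using A(1,2) B(1,2)
    by (intro exI[of _ "A \<inter> B"]) auto
qed

lemma eventually_smooth_at: "smooth_at x f \<Longrightarrow> eventually (\<lambda>z. smooth_at z f) (nhds x)"
  unfolding smooth_at_def eventually_nhds by blast

lemma smooth_at_imp_differentiable: "smooth_at x f \<Longrightarrow> f differentiable at x"
  unfolding smooth_at_def by (metis ndiff_on_Suc)

lemma smooth_at_Dx: "smooth_at x f \<Longrightarrow> smooth_at x (Dx f)"
  unfolding smooth_at_def by (metis ndiff_on_Suc)

lemma smooth_at_funpow_Dx: "smooth_at x f \<Longrightarrow> smooth_at x ((Dx ^^ i) f)"
  by (induction i) (simp_all add: smooth_at_Dx)

lemma jet_Dx: "jet x (Dx f) = fps_deriv (jet x f)"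
proof (rule fps_ext)
  fix n
  have "jet x (Dx f) $ n = (Dx ^^ Suc n) f x / fact n"
    by (simp add: jet_nth funpow_Suc_right del: funpow.simps)
  then show "jet x (Dx f) $ n = fps_deriv (jet x f) $ n"
    by (simp add: jet_nth nonzero_divide_eq_eq del: of_nat_Suc funpow.simps)
qed

lemma jet_funpow_Dx: "jet x ((Dx ^^ i) f) = fps_nth_deriv i (jet x f)"
  by (induction i) (simp_all add: jet_Dx fps_nth_deriv_commute del: fps_nth_deriv.simps(2))

lemma has_vector_derivative_Dx: "f differentiable at x \<Longrightarrow> (f has_vector_derivative Dx f x) (at x)"
  unfolding Dx_def by (simp add: vector_derivative_works[symmetric])

lemma Dx_add:
  "f differentiable at x \<Longrightarrow> g differentiable at x \<Longrightarrow> Dx (\<lambda>z. f z + g z) x = Dx f x + Dx g x"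
  using vector_derivative_at[OF has_vector_derivative_add[OF has_vector_derivative_Dx has_vector_derivative_Dx]]
  by (simp add: Dx_def)

lemma Dx_mult:
  "f differentiable at x \<Longrightarrow> g differentiable at x \<Longrightarrow> Dx (\<lambda>z. f z * g z) x = f x * Dx g x + Dx f x * g x"
  for f g :: "real \<Rightarrow> 'a::real_normed_field"
  using vector_derivative_at[OF has_vector_derivative_mult[OF has_vector_derivative_Dx has_vector_derivative_Dx]]
  by (simp add: Dx_def)

lemma Dx_const: "Dx (\<lambda>z. c) = (\<lambda>z. 0)"
  unfolding Dx_def by (intro ext vector_derivative_at) (rule has_vector_derivative_const)

lemma ndiff_on_const: "ndiff_on n A (\<lambda>z. c)"
  by (induction n arbitrary: c) (auto simp: ndiff_on_Suc Dx_const)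

lemma ndiff_on_add:
  "open A \<Longrightarrow> ndiff_on n A f \<Longrightarrow> ndiff_on n A g \<Longrightarrow> ndiff_on n A (\<lambda>z. f z + g z)"
proof (induction n arbitrary: f g)
  case (Suc n)
  note fg = Suc.prems(2,3)[unfolded ndiff_on_Suc]
  have "ndiff_on n A (Dx (\<lambda>z. f z + g z))"
    by (rule ndiff_on_cong[OF \<open>open A\<close> _ Suc.IH[of "Dx f" "Dx g"]]) (use fg \<open>open A\<close> in \<open>simp_all add: Dx_add\<close>)
  then show ?case using fg by (simp add: ndiff_on_Suc)
qed simp

lemma ndiff_on_mult:
  "open A \<Longrightarrow> ndiff_on n A f \<Longrightarrow> ndiff_on n A g \<Longrightarrow> ndiff_on n A (\<lambda>z. f z * g z)"
proof (induction n arbitrary: f g)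
  case (Suc n)
  note fg = Suc.prems(2,3)[unfolded ndiff_on_Suc]
  have "ndiff_on n A f" "ndiff_on n A g"
    using Suc.prems ndiff_on_mono[of "Suc n" A _ n A] by simp_all
  then have "ndiff_on n A (\<lambda>z. f z * Dx g z + Dx f z * g z)"
    using fg \<open>open A\<close> by (intro ndiff_on_add Suc.IH) simp_all
  then have "ndiff_on n A (Dx (\<lambda>z. f z * g z))"
    by (rule ndiff_on_cong[OF \<open>open A\<close>, rotated]) (use fg in \<open>simp add: Dx_mult\<close>)
  then show ?case using fg by (simp add: ndiff_on_Suc)
qed simp

lemma smooth_at_const [simp]: "smooth_at x (\<lambda>z. c)"
  unfolding smooth_at_def using ndiff_on_const by blast

lemma smooth_at_add: "smooth_at x f \<Longrightarrow> smooth_at x g \<Longrightarrow> smooth_at x (\<lambda>z. f z + g z)"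
  by (erule (1) smooth_at_obtain2) (unfold smooth_at_def, intro exI conjI allI ndiff_on_add)

lemma smooth_at_mult: "smooth_at x f \<Longrightarrow> smooth_at x g \<Longrightarrow> smooth_at x (\<lambda>z. f z * g z)"
  by (erule (1) smooth_at_obtain2) (unfold smooth_at_def, intro exI conjI allI ndiff_on_mult)

lemma smooth_at_sum:
  "(\<And>i. i \<in> I \<Longrightarrow> smooth_at x (f i)) \<Longrightarrow> smooth_at x (\<lambda>z. \<Sum>i\<in>I. f i z)"
  by (induction I rule: infinite_finite_induct) (simp_all add: smooth_at_add)

lemma has_vector_derivative_of_real_diff:
  "((\<lambda>z. of_real (z - y) :: 'a::real_normed_field) has_vector_derivative 1) (at x)"
  using has_vector_derivative_of_real[of "\<lambda>z. z - y" 1 "at x"]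
  by (auto intro!: derivative_eq_intros simp: has_real_derivative_iff_has_vector_derivative[symmetric])

lemma Dx_of_real_diff: "Dx (\<lambda>z. of_real (z - y) :: 'a::real_normed_field) = (\<lambda>z. 1)"
  unfolding Dx_def by (intro ext vector_derivative_at has_vector_derivative_of_real_diff)

lemma smooth_at_of_real_diff: "smooth_at x (\<lambda>z. of_real (z - y) :: 'a::real_normed_field)"
proof -
  have "(\<lambda>z. of_real (z - y) :: 'a) differentiable at x" for x
    using has_vector_derivative_of_real_diff by (rule differentiableI_vector)
  then have "ndiff_on n UNIV (\<lambda>z. of_real (z - y) :: 'a)" for n
    by (cases n) (simp_all add: ndiff_on_Suc Dx_of_real_diff ndiff_on_const del: of_real_diff)
  then show ?thesis unfolding smooth_at_def by blast
qed

lemma jet_const: "jet x (\<lambda>z. c) = fps_const c"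
proof (rule fps_ext)
  fix n show "jet x (\<lambda>z. c) $ n = fps_const c $ n"
  proof (cases n)
    case (Suc k)
    have "(Dx ^^ k) (\<lambda>z::real. 0::'a) = (\<lambda>z. 0)" by (induction k) (simp_all add: Dx_const)
    then show ?thesis using Suc by (simp add: jet_nth funpow_Suc_right Dx_const del: funpow.simps)
  qed (simp add: jet_nth)
qed

text \<open>In characteristic 0 a coefficient can be recovered from the derivative. This drives the
  inductions for sums and products of jets.\<close>

lemma fps_eq_by_deriv:
  fixes F G :: "'a::field_char_0 fps"
  shows "F $ 0 = G $ 0 \<Longrightarrow> fps_deriv F $ n = fps_deriv G $ n \<Longrightarrow> F $ Suc n = G $ Suc n"
  by (simp del: of_nat_Suc of_nat_add)

lemma jet_add:
  fixes f g :: "real \<Rightarrow> 'a::real_normed_field"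
  assumes "smooth_at x f" "smooth_at x g"
  shows "jet x (\<lambda>z. f z + g z) = jet x f + jet x g"
proof -
  have "jet x (\<lambda>z. f z + g z) $ n = jet x f $ n + jet x g $ n"
    if "smooth_at x f" "smooth_at x g" for n and f g :: "real \<Rightarrow> 'a"
    using that
  proof (induction n arbitrary: f g)
    case (Suc n)
    have "eventually (\<lambda>z. Dx (\<lambda>z. f z + g z) z = Dx f z + Dx g z) (nhds x)"
      using eventually_smooth_at[OF Suc.prems(1)] eventually_smooth_at[OF Suc.prems(2)]
      by eventually_elim (simp add: Dx_add smooth_at_imp_differentiable)
    from jet_cong[OF this] have "fps_deriv (jet x (\<lambda>z. f z + g z)) $ n = fps_deriv (jet x f + jet x g) $ n"
      using Suc.IH[of "Dx f" "Dx g"] Suc.prems by (simp add: smooth_at_Dx jet_Dx[symmetric] del: fps_deriv_nth)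
    from fps_eq_by_deriv[OF _ this] show ?case by (simp add: jet_nth)
  qed (simp add: jet_nth)
  then show ?thesis using assms by (simp add: fps_eq_iff)
qed

text \<open>The constant terms agree, and Leibniz' rule reduces coefficient n+1 to coefficient n for
  the pairs f, g' and f', g, which is why the induction generalises over both functions.\<close>

lemma jet_mult:
  fixes f g :: "real \<Rightarrow> 'a::real_normed_field"
  assumes "smooth_at x f" "smooth_at x g"
  shows "jet x (\<lambda>z. f z * g z) = jet x f * jet x g"
proof -
  have "jet x (\<lambda>z. f z * g z) $ n = (jet x f * jet x g) $ n"
    if "smooth_at x f" "smooth_at x g" for n and f g :: "real \<Rightarrow> 'a"
    using that
  proof (induction n arbitrary: f g)
    case (Suc n)
    have "eventually (\<lambda>z. Dx (\<lambda>z. f z * g z) z = f z * Dx g z + Dx f z * g z) (nhds x)"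
      using eventually_smooth_at[OF Suc.prems(1)] eventually_smooth_at[OF Suc.prems(2)]
      by eventually_elim (simp add: Dx_mult smooth_at_imp_differentiable)
    from jet_cong[OF this] have "fps_deriv (jet x (\<lambda>z. f z * g z)) $ n = fps_deriv (jet x f * jet x g) $ n"
      using Suc.IH[of f "Dx g"] Suc.IH[of "Dx f" g] Suc.prems
      by (simp add: smooth_at_Dx smooth_at_mult jet_add jet_Dx[symmetric] fps_deriv_mult del: fps_deriv_nth)
    from fps_eq_by_deriv[OF _ this] show ?case by (simp add: jet_nth)
  qed (simp add: jet_nth)
  then show ?thesis using assms by (simp add: fps_eq_iff)
qed

lemma jet_sum:
  "finite I \<Longrightarrow> (\<And>i. i \<in> I \<Longrightarrow> smooth_at x (f i)) \<Longrightarrow> jet x (\<lambda>z. \<Sum>i\<in>I. f i z) = (\<Sum>i\<in>I. jet x (f i))"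
  by (induction I rule: finite_induct) (simp_all add: jet_const jet_add smooth_at_sum)

lemma jet_of_real_diff: "jet y (\<lambda>z. of_real (z - y)) = fps_X"
proof (rule fps_ext)
  fix n show "jet y (\<lambda>z. of_real (z - y) :: 'a) $ n = fps_X $ n"
  proof (cases n)
    case (Suc k)
    have "jet y (\<lambda>z. of_real (z - y) :: 'a) $ Suc k = (Dx ^^ k) (\<lambda>z. 1 :: 'a) y / fact (Suc k)"
      by (simp add: jet_nth funpow_Suc_right Dx_of_real_diff del: funpow.simps of_real_diff fact_Suc)
    moreover have "jet y (\<lambda>z. 1 :: 'a) $ k = (if k = 0 then 1 else 0)"
      by (simp add: jet_const)
    ultimately show ?thesis using Suc by (auto simp: jet_nth split: if_splits)
  qed (simp add: jet_nth)
qed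

section \<open>Restriction of smooth functions to lines\<close>

lemma smooth_on_frechet_derivative:
  "smooth_on S f \<Longrightarrow> smooth_on S (\<lambda>x. frechet_derivative f (at x) v)"
  unfolding smooth_on_def using higher_differentiable_on.simps(2) by blast

lemma smooth_on_imp_differentiable: "smooth_on S f \<Longrightarrow> x \<in> S \<Longrightarrow> f differentiable at x"
  unfolding smooth_on_def using higher_differentiable_on.simps(2) by blast

text \<open>Along the line, \<open>Dx\<close> is the directional derivative in direction
  \<open>v\<close>, which is again smooth on \<open>S\<close>; this can be repeated. It serves for
  the slices of Hadamard coefficients at fixed y and for functions of one variable.\<close>

lemma smooth_on_line_imp_smooth_at:
  fixes F :: "'b::real_normed_vector \<Rightarrow> 'a::real_normed_field"
  assumes S: "open S" and F: "smooth_on S F" and x: "a + x *\<^sub>R v \<in> S"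
  shows "smooth_at x (\<lambda>z. F (a + z *\<^sub>R v))"
proof -
  define A where "A = (\<lambda>z. a + z *\<^sub>R v) -` S"
  have A: "open A" unfolding A_def by (intro open_vimage S continuous_intros)
  have deriv: "((\<lambda>z. G (a + z *\<^sub>R v)) has_vector_derivative frechet_derivative G (at (a + z *\<^sub>R v)) v) (at z)"
    if "smooth_on S G" "z \<in> A" for G :: "'b \<Rightarrow> 'a" and z
  proof -
    have d: "G differentiable at (a + z *\<^sub>R v)"
      using that(2) smooth_on_imp_differentiable[OF that(1)] by (simp add: A_def)
    have "((\<lambda>z. a + z *\<^sub>R v) has_derivative (\<lambda>t. t *\<^sub>R v)) (at z)"
      by (auto intro!: derivative_eq_intros)
    from has_derivative_compose[OF this d[unfolded frechet_derivative_works]] show ?thesis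
      unfolding has_vector_derivative_def by (simp add: linear_scale[OF linear_frechet_derivative[OF d]])
  qed
  have "ndiff_on n A (\<lambda>z. G (a + z *\<^sub>R v))" if "smooth_on S G" for n and G :: "'b \<Rightarrow> 'a"
    using that
  proof (induction n arbitrary: G)
    case (Suc n)
    have "ndiff_on n A (Dx (\<lambda>z. G (a + z *\<^sub>R v)))"
      by (rule ndiff_on_cong[OF A _ Suc.IH[OF smooth_on_frechet_derivative[OF Suc.prems, of v]]])
         (simp add: Dx_def vector_derivative_at[OF deriv[OF Suc.prems]])
    moreover have "(\<lambda>z. G (a + z *\<^sub>R v)) differentiable at z" if "z \<in> A" for z
      using deriv[OF Suc.prems that] by (rule differentiableI_vector)
    ultimately show ?case unfolding ndiff_on_Suc by blast
  qed simp
  from this[OF F] show ?thesis unfolding smooth_at_def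
    by (intro exI[of _ A]) (use A x in \<open>simp add: A_def\<close>)
qed

section \<open>Jets of the heat expansion\<close>

lemma
  fixes f :: "real \<Rightarrow> 'a::real_normed_field"
  assumes "smooth_at y f"
  shows smooth_at_cmult: "smooth_at y (\<lambda>x. c * f x)"
    and jet_cmult: "jet y (\<lambda>x. c * f x) = fps_const c * jet y f"
    and smooth_at_of_real_diff_mult: "smooth_at y (\<lambda>x. of_real (x - y) * f x)"
    and jet_of_real_diff_mult: "jet y (\<lambda>x. of_real (x - y) * f x) = fps_X * jet y f"
  using assms
  by (simp_all add: jet_mult jet_const jet_of_real_diff smooth_at_mult smooth_at_of_real_diff del: of_real_diff)

lemmas jet_simps = smooth_at_cmult jet_cmult smooth_at_of_real_diff_mult jet_of_real_diff_mult
  smooth_at_add jet_add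

lemma formal_dx_jet:
  fixes V :: "'a::real_normed_field expansion"
  assumes V: "\<And>n j. j \<in> {0, 1} \<Longrightarrow> smooth_at y (\<lambda>x. V n j x y)"
    and v: "\<And>n j. j \<in> {0, 1} \<Longrightarrow> jet y (\<lambda>x. V n j x y) = v n j"
    and j: "j \<in> {0, 1}"
  shows "smooth_at y (\<lambda>x. formal_dx V n j x y)"
    and "jet y (\<lambda>x. formal_dx V n j x y) = fps_dx v n j"
proof -
  have V': "smooth_at y (\<lambda>x. V n 0 x y)" "smooth_at y (\<lambda>x. V n 1 x y)" for n
    by (rule V, simp)+
  have v': "jet y (\<lambda>x. V n 0 x y) = v n 0" "jet y (\<lambda>x. V n 1 x y) = v n 1" for n
    by (rule v, simp)+
  have eq0: "(\<lambda>x. formal_dx V n 0 x y) = (\<lambda>x. Dx (\<lambda>x. V n 0 x y) x + (- 1 / 3) * (of_real (x - y) * V (n + 1) 1 x y))"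
    by (rule ext) (simp add: formal_dx_def)
  have eq1: "(\<lambda>x. formal_dx V n 1 x y) = (\<lambda>x. Dx (\<lambda>x. V n 1 x y) x + V n 0 x y)"
    by (rule ext) (simp add: formal_dx_def)
  have m3: "fps_const (- 1 / 3) = - fps_const (1 / 3 :: 'a)" by simp
  have "smooth_at y (\<lambda>x. formal_dx V n 0 x y)" "smooth_at y (\<lambda>x. formal_dx V n 1 x y)"
    unfolding eq0 eq1 by (simp_all only: jet_simps V' smooth_at_Dx)
  then show "smooth_at y (\<lambda>x. formal_dx V n j x y)" using j by auto
  have "jet y (\<lambda>x. formal_dx V n 0 x y) = fps_dx v n 0" "jet y (\<lambda>x. formal_dx V n 1 x y) = fps_dx v n 1"
    unfolding eq0 eq1
    by (simp_all only: jet_simps V' v' smooth_at_Dx jet_Dx fps_dx_def m3) (simp_all add: mult.assoc del: fps_const_neg)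
  then show "jet y (\<lambda>x. formal_dx V n j x y) = fps_dx v n j" using j by auto
qed

lemma formal_dt_jet:
  fixes V :: "'a::real_normed_field expansion"
  assumes V: "\<And>n j. j \<in> {0, 1} \<Longrightarrow> smooth_at y (\<lambda>x. V n j x y)"
    and v: "\<And>n j. j \<in> {0, 1} \<Longrightarrow> jet y (\<lambda>x. V n j x y) = v n j"
    and j: "j \<in> {0, 1}"
  shows "jet y (\<lambda>x. formal_dt V n j x y) = fps_dt v n j"
proof -
  have V': "smooth_at y (\<lambda>x. V n 0 x y)" "smooth_at y (\<lambda>x. V n 1 x y)" for n
    by (rule V, simp)+
  have v': "jet y (\<lambda>x. V n 0 x y) = v n 0" "jet y (\<lambda>x. V n 1 x y) = v n 1" for n
    by (rule v, simp)+
  have eq0: "(\<lambda>x. formal_dt V n 0 x y) = (\<lambda>x. (of_int (n + 1) - 1/3) * V (n + 1) 0 x y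
     + (1 / 9) * (of_real (x - y) * (of_real (x - y) * V (n + 2) 1 x y)))"
    by (rule ext) (simp add: formal_dt_def power2_eq_square)
  have eq1: "(\<lambda>x. formal_dt V n 1 x y) = (\<lambda>x. (of_int (n + 1) - 2/3) * V (n + 1) 1 x y
     + (- 1 / 3) * (of_real (x - y) * V (n + 1) 0 x y))"
    by (rule ext) (simp add: formal_dt_def)
  have m3: "fps_const (- 1 / 3) = - fps_const (1 / 3 :: 'a)" by simp
  have "jet y (\<lambda>x. formal_dt V n 0 x y) = fps_dt v n 0" "jet y (\<lambda>x. formal_dt V n 1 x y) = fps_dt v n 1"
    unfolding eq0 eq1
    by (simp_all only: jet_simps V' v' fps_dt_def m3) (simp_all add: mult.assoc power2_eq_square del: fps_const_neg)
  then show ?thesis using j by auto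
qed

lemma formal_L_jet:
  fixes V :: "'a::real_normed_field expansion"
  assumes u: "smooth_at y u0" "smooth_at y u1"
    and V: "\<And>n j. j \<in> {0, 1} \<Longrightarrow> smooth_at y (\<lambda>x. V n j x y)"
    and v: "\<And>n j. j \<in> {0, 1} \<Longrightarrow> jet y (\<lambda>x. V n j x y) = v n j"
    and j: "j \<in> {0, 1}"
  shows "jet y (\<lambda>x. formal_L u0 u1 V n j x y) = fps_L (jet y u0) (jet y u1) v n j"
proof -
  have d1: "smooth_at y (\<lambda>x. formal_dx V n j x y)" "jet y (\<lambda>x. formal_dx V n j x y) = fps_dx v n j"
    if "j \<in> {0, 1}" for n j
    using formal_dx_jet[of y V v, OF V v that] by auto
  have d2: "smooth_at y (\<lambda>x. formal_dx (formal_dx V) n j x y)"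
    "jet y (\<lambda>x. formal_dx (formal_dx V) n j x y) = fps_dx (fps_dx v) n j"
    if "j \<in> {0, 1}" for n j
    using formal_dx_jet[of y "formal_dx V" "fps_dx v", OF d1 that] by auto
  have d3: "smooth_at y (\<lambda>x. formal_dx (formal_dx (formal_dx V)) n j x y)"
    "jet y (\<lambda>x. formal_dx (formal_dx (formal_dx V)) n j x y) = fps_dx (fps_dx (fps_dx v)) n j"
    if "j \<in> {0, 1}" for n j
    using formal_dx_jet[of y "formal_dx (formal_dx V)" "fps_dx (fps_dx v)", OF d2 that] by auto
  have "(formal_dx ^^ 3) V = formal_dx (formal_dx (formal_dx V))"
    by (simp add: numeral_3_eq_3)
  then show ?thesis
    using u d1[OF j] d3[OF j] V[OF j] v[OF j]
    by (simp add: formal_L_def fps_L_def jet_add jet_mult smooth_at_add smooth_at_mult)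
qed

lemma diagonal_nbhd_section:
  assumes "diagonal_nbhd X U" "y \<in> X"
  shows "eventually (\<lambda>x. (x, y) \<in> U) (nhds y)"
proof (rule eventually_nhds_openI[of "(\<lambda>x. (x, y)) -` U"])
  show "open ((\<lambda>x. (x, y)) -` U)"
    using assms by (intro open_vimage continuous_intros) (auto simp: diagonal_nbhd_def)
qed (use assms in \<open>auto simp: diagonal_nbhd_def\<close>)

definition expansion_jet :: "real \<Rightarrow> 'a::real_normed_field expansion \<Rightarrow> int \<Rightarrow> nat \<Rightarrow> 'a fps" where
  "expansion_jet y V n j = jet y (\<lambda>x. V n j x y)"

lemma heat_expansion_jet:
  "n < 0 \<Longrightarrow> expansion_jet y (heat_expansion H) n j = 0"
  "expansion_jet y (heat_expansion H) 0 0 = 1"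
  "expansion_jet y (heat_expansion H) 0 1 = 0"
  "k \<ge> 1 \<Longrightarrow> expansion_jet y (heat_expansion H) (int k) j = jet y (\<lambda>x. H k j x y)"
  by (simp_all add: expansion_jet_def heat_expansion_def jet_const)

text \<open>For fixed y the heat equation holds for all x near y, so the Taylor series of both sides
  in x at y coincide, and the formal operations commute with Taylor expansion.\<close>

lemma hadamard_jets:
  fixes u0 u1 :: "real \<Rightarrow> 'a::real_normed_field"
  assumes H: "hadamard_coefficients X u0 u1 H" and y: "y \<in> X"
    and u: "smooth_at y u0" "smooth_at y u1" and j: "j \<in> {0, 1}"
  shows "fps_dt (expansion_jet y (heat_expansion H)) n j =
    fps_L (jet y u0) (jet y u1) (expansion_jet y (heat_expansion H)) n j"
proof -
  note H1 = conjunct1[OF H[unfolded hadamard_coefficients_def], rule_format]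
    and H2 = conjunct2[OF H[unfolded hadamard_coefficients_def], rule_format]
  let ?V = "heat_expansion H"
  let ?v = "expansion_jet y ?V"
  have V: "smooth_at y (\<lambda>x. ?V n j x y)" if j: "j \<in> {0, 1}" for n j
  proof (cases "n \<le> 0")
    case True
    then show ?thesis by (cases "n = 0") (simp_all add: heat_expansion_def)
  next
    case False
    then have "nat n \<ge> 1" by simp
    then obtain U where U: "diagonal_nbhd X U" "smooth_on U (\<lambda>(x, y). H (nat n) j x y)"
      using H2[of "nat n" j, OF _ j] by blast
    \<comment> \<open>The slice at fixed y is the line through (0, y) in direction (1, 0).\<close>
    have "smooth_at y (\<lambda>z. (\<lambda>(x, y). H (nat n) j x y) ((0, y) + z *\<^sub>R (1, 0)))"
      by (rule smooth_on_line_imp_smooth_at[OF _ U(2)]) (use U(1) y in \<open>auto simp: diagonal_nbhd_def\<close>)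
    then show ?thesis using False by (simp add: heat_expansion_def)
  qed
  obtain U where U: "diagonal_nbhd X U" "\<And>x y. (x, y) \<in> U \<Longrightarrow> formal_dt ?V n j x y = formal_L u0 u1 ?V n j x y"
    using H1[OF j, of n] by blast
  have "jet y (\<lambda>x. formal_dt ?V n j x y) = jet y (\<lambda>x. formal_L u0 u1 ?V n j x y)"
    using eventually_mono[OF diagonal_nbhd_section[OF U(1) y] U(2)] by (rule jet_cong)
  then show ?thesis
    using formal_dt_jet[of y ?V ?v, OF V expansion_jet_def[symmetric] j]
      formal_L_jet[of y u0 u1 ?V ?v, OF u V expansion_jet_def[symmetric] j] by simp
qed

section \<open>Jets of pseudo-differential operators\<close>

text \<open>In contrast to \<open>psido\<close>, the bound on the order is explicit, so that it adds
  up under products, and smoothness is the local notion behind jets.\<close>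

definition psido_of_order :: "real set \<Rightarrow> int \<Rightarrow> 'a::real_normed_field psido \<Rightarrow> bool" where
  "psido_of_order X M R \<longleftrightarrow>
     (\<forall>i>M. \<forall>x\<in>X. R i x = 0) \<and> (\<forall>i. \<forall>x\<in>X. smooth_at x (R i))"

definition psido_jet :: "real \<Rightarrow> int \<Rightarrow> 'a::real_normed_field psido \<Rightarrow> nat \<Rightarrow> 'a fps" where
  "psido_jet x M R n = jet x (R (M - int n))"

context
  fixes X :: "real set" and M N :: int and R S :: "'a::real_normed_field psido"
  assumes X: "open X" and R: "psido_of_order X M R" and S: "psido_of_order X N S"
begin

lemma psido_term_eq_0:
  assumes "x \<in> X" "k > M \<or> n - k + int i > N"
  shows "psido_term R S n x (k, i) = 0"
proof (cases "k > M")
  case True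
  then show ?thesis using R assms(1) by (simp add: psido_term_def psido_of_order_def)
next
  case False
  then have "n - k + int i > N" using assms(2) by simp
  then have "(Dx ^^ i) (S (n - k + int i)) x = 0"
    by (intro funpow_Dx_eq_0[OF X _ assms(1)]) (use S in \<open>auto simp: psido_of_order_def\<close>)
  then show ?thesis by (simp add: psido_term_def)
qed

text \<open>Outside the triangle one of the two factors lies above its order bound and the term
  vanishes. Counting down from the bounds turns the sum over the support into one with a range
  independent of x.\<close>

lemma psido_mult_eq:
  assumes "x \<in> X"
  shows "psido_mult R S (M + N - int n) x = (\<Sum>i\<le>n. \<Sum>l\<le>n - i.
    (of_int (M - int i) gchoose l) * R (M - int i) x * (Dx ^^ l) (S (N - int (n - i - l))) x)"
proof -
  let ?t = "psido_term R S (M + N - int n) x"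
  let ?B = "Sigma {..n} (\<lambda>i. {..n - i})"
  have "psido_mult R S (M + N - int n) x = sum ?t ((\<lambda>(i, l). (M - int i, l)) ` ?B)"
    unfolding psido_mult_def
  proof (rule sum.mono_neutral_left)
    show "{p. ?t p \<noteq> 0} \<subseteq> (\<lambda>(i, l). (M - int i, l)) ` ?B"
    proof
      fix p assume p: "p \<in> {p. ?t p \<noteq> 0}"
      obtain k l where kl: "p = (k, l)" by (cases p)
      have "\<not> (k > M \<or> (M + N - int n) - k + int l > N)"
        using p psido_term_eq_0[OF assms] unfolding kl by blast
      then have "(nat (M - k), l) \<in> ?B" "p = (M - int (nat (M - k)), l)"
        unfolding kl by auto
      then show "p \<in> (\<lambda>(i, l). (M - int i, l)) ` ?B" by force
    qed
  qed auto
  also have "\<dots> = (\<Sum>(i, l)\<in>?B. ?t (M - int i, l))"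
    by (subst sum.reindex) (auto simp: inj_on_def split_def)
  also have "\<dots> = (\<Sum>i\<le>n. \<Sum>l\<le>n - i. ?t (M - int i, l))"
    by (subst sum.Sigma) auto
  also have "\<dots> = (\<Sum>i\<le>n. \<Sum>l\<le>n - i.
    (of_int (M - int i) gchoose l) * R (M - int i) x * (Dx ^^ l) (S (N - int (n - i - l))) x)"
  proof (intro sum.cong refl)
    fix i l assume "i \<in> {..n}" "l \<in> {..n - i}"
    then have "M + N - int n - (M - int i) + int l = N - int (n - i - l)" by auto
    then show "?t (M - int i, l) =
      (of_int (M - int i) gchoose l) * R (M - int i) x * (Dx ^^ l) (S (N - int (n - i - l))) x"
      by (simp only: psido_term_def prod.case)
  qed
  finally show ?thesis .
qed

lemma psido_mult_eq_0:
  assumes "x \<in> X" "k > M + N"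
  shows "psido_mult R S k x = 0"
  unfolding psido_mult_def
proof (rule sum.neutral, rule ballI)
  fix p assume "p \<in> {p. psido_term R S k x p \<noteq> 0}"
  then show "psido_term R S k x p = 0"
    using psido_term_eq_0[OF assms(1), of "fst p" k "snd p"] assms(2) by force
qed

text \<open>The finite formula of \<open>psido_mult_eq\<close> holds near x with fixed ranges, so
  Taylor expansion may be applied term by term.\<close>

lemma psido_mult_smooth_jet:
  assumes x: "x \<in> X"
  shows "smooth_at x (psido_mult R S (M + N - int n))"
    and "jet x (psido_mult R S (M + N - int n)) = symb_mult (of_int M) (psido_jet x M R) (psido_jet x N S) n"
proof -
  let ?f = "\<lambda>z. \<Sum>i\<le>n. \<Sum>l\<le>n - i.
    (of_int (M - int i) gchoose l) * (R (M - int i) z * (Dx ^^ l) (S (N - int (n - i - l))) z)"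
  have ev: "eventually (\<lambda>z. ?f z = psido_mult R S (M + N - int n) z) (nhds x)"
    by (rule eventually_nhds_openI[OF X x]) (simp add: psido_mult_eq mult.assoc)
  have RS: "smooth_at x (R i)" "smooth_at x ((Dx ^^ l) (S i))" for i l
    using R S x by (auto simp: psido_of_order_def intro: smooth_at_funpow_Dx)
  have sm: "smooth_at x (\<lambda>z. c * (R i z * (Dx ^^ l) (S j) z))" for c i l j
    by (intro smooth_at_cmult smooth_at_mult RS)
  then show "smooth_at x (psido_mult R S (M + N - int n))"
    by (intro smooth_at_cong[OF ev] smooth_at_sum)
  have "jet x (psido_mult R S (M + N - int n)) = jet x ?f"
    by (rule jet_cong[OF ev, symmetric])
  also have "\<dots> = (\<Sum>i\<le>n. \<Sum>l\<le>n - i. jet x (\<lambda>z.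
      (of_int (M - int i) gchoose l) * (R (M - int i) z * (Dx ^^ l) (S (N - int (n - i - l))) z)))"
    using sm by (simp only: jet_sum smooth_at_sum finite_atMost)
  also have "\<dots> = (\<Sum>i\<le>n. \<Sum>l\<le>n - i. fps_const (of_int (M - int i) gchoose l) *
     (jet x (R (M - int i)) * fps_nth_deriv l (jet x (S (N - int (n - i - l))))))"
    by (simp only: jet_cmult jet_mult smooth_at_mult RS jet_funpow_Dx)
  also have "\<dots> = symb_mult (of_int M) (psido_jet x M R) (psido_jet x N S) n"
    by (simp add: symb_mult_def dpow_mult_def psido_jet_def sum_distrib_left mult.left_commute)
  finally show "jet x (psido_mult R S (M + N - int n)) = symb_mult (of_int M) (psido_jet x M R) (psido_jet x N S) n" .
qed

lemma psido_jet_mult: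
  "x \<in> X \<Longrightarrow> psido_jet x (M + N) (psido_mult R S) = symb_mult (of_int M) (psido_jet x M R) (psido_jet x N S)"
  by (rule ext) (simp add: psido_jet_def[of x "M + N"] psido_mult_smooth_jet(2))

lemma psido_of_order_mult: "psido_of_order X (M + N) (psido_mult R S)"
  unfolding psido_of_order_def
proof (intro conjI allI impI ballI)
  fix i x assume x: "x \<in> X"
  show "smooth_at x (psido_mult R S i)"
  proof (cases "i > M + N")
    case True
    then have "eventually (\<lambda>z. 0 = psido_mult R S i z) (nhds x)"
      by (intro eventually_nhds_openI[OF X x]) (simp add: psido_mult_eq_0)
    then show ?thesis by (rule smooth_at_cong) simp
  next
    case False
    then show ?thesis using psido_mult_smooth_jet(1)[OF x, of "nat (M + N - i)"] by simp
  qed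
qed (simp add: psido_mult_eq_0)

end

lemma psido_of_order_one: "psido_of_order X 0 psido_one"
  by (auto simp: psido_of_order_def psido_one_def[abs_def])

lemma psido_jet_one: "psido_jet x 0 psido_one = symb_one"
  by (auto simp: psido_jet_def psido_one_def[abs_def] symb_one_def jet_const fun_eq_iff)

lemma psido_power_of_order:
  fixes R :: "'a::real_normed_field psido"
  assumes "open X" "psido_of_order X 1 R"
  shows "psido_of_order X (int m) (psido_power R m)"
    and "x \<in> X \<Longrightarrow> psido_jet x (int m) (psido_power R m) = symb_power (psido_jet x 1 R) m"
proof -
  show *: "psido_of_order X (int m) (psido_power R m)" for m
  proof (induction m)
    case (Suc m)
    then show ?case using psido_of_order_mult[OF assms Suc] by simp
  qed (simp add: psido_of_order_one)
  show "psido_jet x (int m) (psido_power R m) = symb_power (psido_jet x 1 R) m" if "x \<in> X"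
  proof (induction m)
    case (Suc m)
    then show ?case using psido_jet_mult[OF assms * that, of m] by simp
  qed (simp add: psido_jet_one)
qed

lemma smooth_on_imp_smooth_at:
  "open X \<Longrightarrow> smooth_on X f \<Longrightarrow> x \<in> X \<Longrightarrow> smooth_at x f" for f :: "real \<Rightarrow> 'a::real_normed_field"
  using smooth_on_line_imp_smooth_at[of X f 0 x 1] by simp

lemma Lop_eq:
  "Lop u0 u1 i = (if i = 3 then \<lambda>x. 1 else if i = 1 then u1 else if i = 0 then u0 else (\<lambda>x. 0))"
  by (rule ext) (simp add: Lop_def)

lemma psido_of_order_Lop:
  "(\<And>x. x \<in> X \<Longrightarrow> smooth_at x u0) \<Longrightarrow> (\<And>x. x \<in> X \<Longrightarrow> smooth_at x u1) \<Longrightarrow> psido_of_order X 3 (Lop u0 u1)"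
  by (auto simp: psido_of_order_def Lop_eq)

lemma psido_jet_Lop: "psido_jet x 3 (Lop u0 u1) = L_symb (jet x u0) (jet x u1)"
  by (auto simp: psido_jet_def Lop_eq L_symb_def jet_const fun_eq_iff)

lemma is_cube_root_symb:
  fixes P :: "'a::real_normed_field psido"
  assumes X: "open X" and P: "is_cube_root X (Lop u0 u1) P"
  shows "psido_of_order X 1 P"
    and "x \<in> X \<Longrightarrow> psido_jet x 1 P 0 = 1"
    and "x \<in> X \<Longrightarrow> symb_power (psido_jet x 1 P) 3 = L_symb (jet x u0) (jet x u1)"
proof -
  show P1: "psido_of_order X 1 P"
    using P smooth_on_imp_smooth_at[OF X] unfolding is_cube_root_def psido_def psido_of_order_def by blast
  assume x: "x \<in> X"
  have "eventually (\<lambda>z. P 1 z = 1) (nhds x)"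
    using P by (intro eventually_nhds_openI[OF X x]) (auto simp: is_cube_root_def)
  from jet_cong[OF this] show "psido_jet x 1 P 0 = 1"
    by (simp add: psido_jet_def jet_const)
  have "psido_jet x 3 (psido_power P 3) = psido_jet x 3 (Lop u0 u1)"
  proof
    fix n
    have "eventually (\<lambda>z. psido_power P 3 (3 - int n) z = Lop u0 u1 (3 - int n) z) (nhds x)"
      using P by (intro eventually_nhds_openI[OF X x]) (auto simp: is_cube_root_def psido_eq_def)
    then show "psido_jet x 3 (psido_power P 3) n = psido_jet x 3 (Lop u0 u1) n"
      unfolding psido_jet_def by (rule jet_cong)
  qed
  then show "symb_power (psido_jet x 1 P) 3 = L_symb (jet x u0) (jet x u1)"
    using psido_power_of_order(2)[OF X P1 x, of 3] by (simp add: psido_jet_Lop)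
qed

section \<open>The commutator with the nonnegative part\<close>

lemma symb_mult_add_left: "symb_mult \<mu> (\<lambda>n. r n + s n) t n = symb_mult \<mu> r t n + symb_mult \<mu> s t n"
  by (simp add: symb_mult_def distrib_right sum.distrib)

lemma symb_mult_add_right: "symb_mult \<mu> r (\<lambda>n. s n + t n) n = symb_mult \<mu> r s n + symb_mult \<mu> r t n"
  by (simp add: symb_mult_def dpow_mult_add distrib_left sum.distrib)

lemma dpow_mult_L_symb:
  "dpow_mult \<mu> (L_symb u0 u1) 0 = 1"
  "dpow_mult \<mu> (L_symb u0 u1) (Suc 0) = 0"
  "dpow_mult \<mu> (L_symb u0 u1) (Suc (Suc 0)) = u1"
  by (simp_all add: dpow_mult_def L_symb_def numeral_2_eq_2)

text \<open>Split \<open>c\<close> into its differential part \<open>d\<close> and the rest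
  \<open>e\<close>. As \<open>c\<close> commutes with L, the commutator of \<open>d\<close> with L
  is that of L with \<open>e\<close>, which has order at most 1; its two top coefficients are
  computed directly. Index \<open>n\<close> belongs to order m+3-n.\<close>

lemma symb_commutator_differential_part:
  fixes c :: "nat \<Rightarrow> 'a::field_char_0 fps"
  assumes comm: "symb_mult (of_nat m) c (L_symb u0 u1) = symb_mult 3 (L_symb u0 u1) c"
  defines "d \<equiv> \<lambda>i. if i \<le> m then c i else 0"
  shows "symb_mult (of_nat m) d (L_symb u0 u1) n - symb_mult 3 (L_symb u0 u1) d n =
    (if n = m + 2 then 3 * fps_deriv (c (m + 1))
     else if n = m + 3 then 3 * fps_deriv (fps_deriv (c (m + 1)) + c (m + 2)) else 0)"
proof (cases "n \<le> m + 3")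
  case True
  define e where "e i = (if i \<le> m then 0 else c i)" for i
  let ?L = "L_symb u0 u1"
  have "c = (\<lambda>i. d i + e i)" by (auto simp: d_def e_def)
  then have "symb_mult (of_nat m) d ?L n + symb_mult (of_nat m) e ?L n = symb_mult 3 ?L d n + symb_mult 3 ?L e n"
    using fun_cong[OF comm, of n] symb_mult_add_left[of "of_nat m" d e ?L n] symb_mult_add_right[of 3 ?L d e n] by simp
  then have *: "symb_mult (of_nat m) d ?L n - symb_mult 3 ?L d n = symb_mult 3 ?L e n - symb_mult (of_nat m) e ?L n"
    by (simp add: algebra_simps)
  have e0: "e i = 0" if "i \<le> m" for i using that by (simp add: e_def)
  have left0: "(\<Sum>i\<le>m. e i * t i) = 0" for t
    by (rule sum.neutral) (simp add: e_def)
  consider "n \<le> m" | "n = Suc m" | "n = Suc (Suc m)" | "n = Suc (Suc (Suc m))" using True by linarith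
  then have "symb_mult 3 ?L e n - symb_mult (of_nat m) e ?L n =
    (if n = m + 2 then 3 * fps_deriv (c (m + 1))
     else if n = m + 3 then 3 * fps_deriv (fps_deriv (c (m + 1)) + c (m + 2)) else 0)"
  proof cases
    case 1
    then show ?thesis
      by (simp add: symb_mult_L_symb symb_mult_def[of "of_nat m"] e0 dpow_mult_def)
  next
    case 2
    then show ?thesis
      by (simp add: symb_mult_L_symb symb_mult_def[of "of_nat m"] e0 dpow_mult_3 dpow_mult_one left0 dpow_mult_L_symb numeral_2_eq_2)
  next
    case 3
    then show ?thesis
      by (simp add: symb_mult_L_symb symb_mult_def[of "of_nat m"] e0 dpow_mult_3 dpow_mult_one left0 dpow_mult_L_symb numeral_2_eq_2) (simp add: e_def)
  next
    case 4
    then show ?thesis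
      by (simp add: symb_mult_L_symb symb_mult_def[of "of_nat m"] e0 dpow_mult_3 dpow_mult_one left0 dpow_mult_L_symb numeral_2_eq_2) (simp add: e_def algebra_simps)
  qed
  with * show ?thesis by simp
next
  \<comment> \<open>Negative orders are absent because both factors are differential operators:
    either the coefficient or the binomial coefficient is zero.\<close>
  case False
  have L0: "L_symb u0 u1 i = 0" if "i > 3" for i using that by (simp add: L_symb_def)
  have choose0: "(of_nat k gchoose l) = (0::'a)" if "k < l" for k l
    using that by (simp add: binomial_gbinomial[symmetric] binomial_eq_0)
  have "dpow_mult (of_nat m - of_nat i) (L_symb u0 u1) (n - i) = 0" if "i \<le> m" for i
    unfolding dpow_mult_def
  proof (rule sum.neutral, rule ballI)
    fix l
    show "fps_const (of_nat m - of_nat i gchoose l) * fps_nth_deriv l (L_symb u0 u1 (n - i - l)) = 0"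
    proof (cases "l \<le> m - i")
      case True
      then have "n - i - l > 3" using that False by linarith
      then show ?thesis by (simp add: L0)
    next
      case False
      then show ?thesis using choose0[of "m - i" l] that by (simp add: of_nat_diff)
    qed
  qed
  then have 1: "symb_mult (of_nat m) d (L_symb u0 u1) n = 0"
    unfolding symb_mult_def by (intro sum.neutral) (auto simp: d_def)
  have "dpow_mult 3 d n = 0"
    unfolding dpow_mult_def
  proof (rule sum.neutral, rule ballI)
    fix l
    show "fps_const (3 gchoose l) * fps_nth_deriv l (d (n - l)) = 0"
      using False choose0[of 3 l] by (cases "l \<le> 3") (auto simp: d_def)
  qed
  then have "symb_mult 3 (L_symb u0 u1) d n = 0"
    using False by (auto simp: symb_mult_L_symb dpow_mult_one d_def)
  with 1 False show ?thesis by simp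
qed

lemma psido_plus_eq: "psido_plus R i = (if i \<ge> 0 then R i else (\<lambda>x. 0))"
  by (rule ext) (simp add: psido_plus_def)

text \<open>Nonnegative orders contribute only derivatives of the delta function: z^l annihilates
  \<open>e\<^sub>i\<close> for natural i < l, since the Pochhammer symbol at -i then contains the
  factor 0.\<close>

lemma delta_eval_first_negative:
  "delta_eval (of_nat m) r (m + 1) = r (m + 1) $ 0"
  "delta_eval (of_nat m) r (m + 2) = r (m + 1) $ 1 + r (m + 2) $ 0"
proof -
  have 0: "(\<Sum>i\<le>m. pochhammer (of_nat i - of_nat m) (Suc m + k - i) * t i) = (0::'a)" for k t
  proof (rule sum.neutral, rule ballI)
    fix i assume "i \<in> {..m}"
    then have "of_nat i - of_nat m = - (of_nat (m - i) :: 'a)" "Suc m + k - i > m - i" by (auto simp: of_nat_diff)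
    then have "pochhammer (of_nat i - of_nat m) (Suc m + k - i) = (0::'a)"
      by (simp only: pochhammer_of_nat_eq_0_iff)
    then show "pochhammer (of_nat i - of_nat m) (Suc m + k - i) * t i = 0" by simp
  qed
  show "delta_eval (of_nat m) r (m + 1) = r (m + 1) $ 0"
    using 0[of 0 "\<lambda>i. r i $ (Suc m - i)"] by (simp add: delta_eval_def)
  show "delta_eval (of_nat m) r (m + 2) = r (m + 1) $ 1 + r (m + 2) $ 0"
    using 0[of 1 "\<lambda>i. r i $ (Suc (Suc m) - i)"] by (simp add: delta_eval_def numeral_2_eq_2 Suc_diff_le)
qed

context
  fixes X :: "real set" and u0 u1 :: "real \<Rightarrow> 'a::real_normed_field" and P :: "'a psido"
  assumes X: "open X" and u0: "smooth_on X u0" and u1: "smooth_on X u1"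
    and P: "is_cube_root X (Lop u0 u1) P"
begin

lemma psido_power_commutator:
  fixes m :: nat
  defines "a \<equiv> psido_power P m (- 1)" and "b \<equiv> psido_power P m (- 2)"
  assumes x: "x \<in> X"
  shows "psido_commutator (psido_plus (psido_power P m)) (Lop u0 u1) i x =
    (if i = 1 then 3 * Dx a x else if i = 0 then 3 * Dx (\<lambda>z. Dx a z + b z) x else 0)"
proof (cases "i \<le> int m + 3")
  case True
  \<comment> \<open>The product has order bound m+3, and symbols count down from it; orders 1 and 0
    are the indices m+2 and m+3.\<close>
  define n where "n = nat (int m + 3 - i)"
  have i: "i = int m + 3 - int n" using True by (simp add: n_def)
  let ?K = "psido_plus (psido_power P m)" and ?L = "L_symb (jet x u0) (jet x u1)"
  let ?c = "symb_power (psido_jet x 1 P) m"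
  note cube = is_cube_root_symb[OF X P]
  note power = psido_power_of_order[OF X cube(1), where m = m]
  have oP: "smooth_at z (psido_power P m j)" if "z \<in> X" for j z
    using power(1) that by (simp add: psido_of_order_def)
  have K: "psido_of_order X (int m) ?K"
    using power(1) by (auto simp: psido_of_order_def psido_plus_eq)
  have K_jet: "psido_jet x (int m) ?K = (\<lambda>n. if n \<le> m then ?c n else 0)"
    unfolding power(2)[OF x, symmetric]
    by (auto simp: fun_eq_iff psido_jet_def psido_plus_eq jet_const)
  have L: "psido_of_order X 3 (Lop u0 u1)"
    using u0 u1 smooth_on_imp_smooth_at[OF X] by (intro psido_of_order_Lop) auto
  have L_jet: "psido_jet x 3 (Lop u0 u1) = ?L" by (rule psido_jet_Lop)
  have "symb_mult (of_nat m) ?c ?L = symb_mult 3 ?L ?c"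
    using symb_power_add_3[OF cube(3)[OF x], of m] symb_power_mult_3[OF cube(3)[OF x], of m] by simp
  note comm = symb_commutator_differential_part[OF this, of n]
  have "psido_mult ?K (Lop u0 u1) i x = symb_mult (of_nat m) (psido_jet x (int m) ?K) ?L n $ 0"
    using arg_cong[OF psido_mult_smooth_jet(2)[OF X K L x, of n], of "\<lambda>f. fps_nth f 0"]
    by (simp add: jet_nth i L_jet)
  moreover have "psido_mult (Lop u0 u1) ?K i x = symb_mult 3 ?L (psido_jet x (int m) ?K) n $ 0"
    using arg_cong[OF psido_mult_smooth_jet(2)[OF X L K x, of n], of "\<lambda>f. fps_nth f 0"]
    by (simp add: jet_nth i L_jet add.commute)
  ultimately have eq: "psido_commutator ?K (Lop u0 u1) i x =
     (if n = m + 2 then 3 * fps_deriv (?c (m + 1))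
     else if n = m + 3 then 3 * fps_deriv (fps_deriv (?c (m + 1)) + ?c (m + 2)) else 0) $ 0"
    unfolding comm[symmetric] K_jet psido_commutator_def by simp
  have c: "?c (m + 1) = jet x a" "?c (m + 2) = jet x b"
    unfolding power(2)[OF x, symmetric] by (simp_all add: psido_jet_def a_def b_def)
  have d1: "(3 * fps_deriv (jet x a)) $ 0 = 3 * Dx a x"
    unfolding jet_Dx[symmetric] by (simp add: jet_nth numeral_fps_const)
  have "fps_deriv (jet x a) + jet x b = jet x (\<lambda>z. Dx a z + b z)"
    unfolding jet_Dx[symmetric] a_def b_def by (simp add: jet_add oP x smooth_at_Dx)
  then have d2: "(3 * fps_deriv (fps_deriv (jet x a) + jet x b)) $ 0 = 3 * Dx (\<lambda>z. Dx a z + b z) x"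
    by (simp only: jet_Dx[symmetric]) (simp add: jet_nth numeral_fps_const)
  have "n = m + 2 \<longleftrightarrow> i = 1" "n = m + 3 \<longleftrightarrow> i = 0" unfolding i by auto
  then show ?thesis unfolding eq c using d1 d2 by auto
next
  case False
  note cube = is_cube_root_symb[OF X P]
  note power = psido_power_of_order[OF X cube(1), where m = m]
  have K: "psido_of_order X (int m) (psido_plus (psido_power P m))"
    using power(1) by (auto simp: psido_of_order_def psido_plus_eq)
  have L: "psido_of_order X 3 (Lop u0 u1)"
    using u0 u1 smooth_on_imp_smooth_at[OF X] by (intro psido_of_order_Lop) auto
  show ?thesis
    using False psido_mult_eq_0[OF X K L x, of i] psido_mult_eq_0[OF X L K x, of i]
    by (simp add: psido_commutator_def)
qed

lemma psido_power_smooth: "x \<in> X \<Longrightarrow> smooth_at x (psido_power P m i)"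
  using psido_power_of_order(1)[OF X is_cube_root_symb(1)[OF X P], of m] by (simp add: psido_of_order_def)

text \<open>Comparison of the coefficients of \<open>e\<^sub>-\<^sub>1\<close> and
  \<open>e\<^sub>-\<^sub>2\<close>, at indices m+1 and m+2. The residue of \<open>m\<close> modulo 3
  decides whether they hold a component j = 0, a component j = 1 or nothing; the x-derivatives are
  first Taylor coefficients of index m+1.\<close>

lemma psido_power_eq_hadamard:
  assumes H: "hadamard_coefficients X u0 u1 H" and k: "k \<ge> 1" and y: "y \<in> X"
  shows "psido_power P (3 * k - 2) (- 1) y = pochhammer (1/3) k * H k 1 y y"
    and "Dx (psido_power P (3 * k - 2) (- 1)) y + psido_power P (3 * k - 2) (- 2) y =
      pochhammer (1/3) k * (H k 0 y y + Dx (\<lambda>x. H k 1 x y) y)"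
    and "psido_power P (3 * k - 1) (- 1) y = pochhammer (2/3) k * H k 0 y y"
    and "Dx (psido_power P (3 * k - 1) (- 1)) y + psido_power P (3 * k - 1) (- 2) y =
      pochhammer (2/3) k * Dx (\<lambda>x. H k 0 x y) y"
    and "psido_power P (3 * k) (- 1) y = 0"
    and "Dx (psido_power P (3 * k) (- 1)) y + psido_power P (3 * k) (- 2) y = 0"
proof -
  have sm: "smooth_at y u0" "smooth_at y u1"
    using smooth_on_imp_smooth_at[OF X _ y] u0 u1 by auto
  define v where "v = expansion_jet y (heat_expansion H)"
  note v = hadamard_jets[OF H y sm, folded v_def] heat_expansion_jet[where y = y and H = H, folded v_def]
  note cube = is_cube_root_symb[OF X P]
  note vk = v(5)[OF k]
  have main: "psido_power P m (- 1) y = hadamard_symb (of_nat m) v (m + 1) $ 0 \<and>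
    Dx (psido_power P m (- 1)) y + psido_power P m (- 2) y =
      hadamard_symb (of_nat m) v (m + 1) $ 1 + hadamard_symb (of_nat m) v (m + 2) $ 0" for m
  proof -
    note power = psido_power_of_order(2)[OF X cube(1) y, where m = m, symmetric]
    have c: "symb_power (psido_jet y 1 P) m (m + 1) = jet y (psido_power P m (- 1))"
      "symb_power (psido_jet y 1 P) m (m + 2) = jet y (psido_power P m (- 2))"
      unfolding power by (simp_all add: psido_jet_def)
    note eq = delta_eval_symb_power_eq_hadamard_symb[of v "jet y u0" "jet y u1" "psido_jet y 1 P",
        OF v(1-4) cube(2,3)[OF y]]
    show ?thesis
      using eq[of m "m + 1"] eq[of m "m + 2"] unfolding delta_eval_first_negative c
      by (simp add: jet_nth)
  qed
  obtain l where l: "k = Suc l" using k by (cases k) auto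
  have idx: "3 * k - 2 = Suc (3 * l)" "3 * k - 1 = Suc (Suc (3 * l))" by (simp_all add: l)
  have tf: "third_fact (of_nat (Suc (3 * l))) k = pochhammer (1/3 :: 'a) k"
    "third_fact (of_nat (Suc (Suc (3 * l)))) k = pochhammer (2/3 :: 'a) k"
    unfolding third_fact_eq_pochhammer by (simp_all add: l add_divide_distrib)
  have e: "3 * Suc l = Suc (Suc (Suc (3 * l)))" by simp
  have s1: "hadamard_symb \<beta> v (Suc (3 * l) + 1) = fps_const (third_fact \<beta> k) * v (int k) 1"
    "hadamard_symb \<beta> v (Suc (3 * l) + 2) = fps_const (third_fact \<beta> k) * v (int k) 0" for \<beta>
    using hadamard_symb_simps(3)[of \<beta> v l] hadamard_symb_simps(1)[of \<beta> v "Suc l", unfolded e]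
    by (simp_all add: l add.commute)
  have s2: "hadamard_symb \<beta> v (Suc (Suc (3 * l)) + 1) = fps_const (third_fact \<beta> k) * v (int k) 0"
    "hadamard_symb \<beta> v (Suc (Suc (3 * l)) + 2) = 0" for \<beta>
    using hadamard_symb_simps(1,2)[of \<beta> v "Suc l", unfolded e]
    by (simp_all add: l add.commute)
  \<comment> \<open>The second symbol sits at a place with j = 1, but its falling factorial at 3k
    contains the factor k - k.\<close>
  have s3: "hadamard_symb (of_nat (3 * k)) v (3 * k + 1) = 0" "hadamard_symb (of_nat (3 * k)) v (3 * k + 2) = 0"
    using hadamard_symb_simps(2)[of "of_nat (3 * k)" v k] hadamard_symb_simps(3)[of "of_nat (3 * k)" v k]
    by (simp_all add: third_fact_Suc)
  show "psido_power P (3 * k - 2) (- 1) y = pochhammer (1/3) k * H k 1 y y"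
    and "Dx (psido_power P (3 * k - 2) (- 1)) y + psido_power P (3 * k - 2) (- 2) y =
      pochhammer (1/3) k * (H k 0 y y + Dx (\<lambda>x. H k 1 x y) y)"
    unfolding idx using main[of "Suc (3 * l)"] unfolding s1 tf vk by (simp_all add: jet_nth distrib_left add.commute)
  show "psido_power P (3 * k - 1) (- 1) y = pochhammer (2/3) k * H k 0 y y"
    and "Dx (psido_power P (3 * k - 1) (- 1)) y + psido_power P (3 * k - 1) (- 2) y =
      pochhammer (2/3) k * Dx (\<lambda>x. H k 0 x y) y"
    unfolding idx using main[of "Suc (Suc (3 * l))"] unfolding s2 tf vk by (simp_all add: jet_nth)
  show "psido_power P (3 * k) (- 1) y = 0"
    and "Dx (psido_power P (3 * k) (- 1)) y + psido_power P (3 * k) (- 2) y = 0"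
    using main[of "3 * k"] unfolding s3 by simp_all
qed

end

section \<open>The Boussinesq hierarchy\<close>

lemma pochhammer_third_nonzero:
  "pochhammer (1/3) k \<noteq> (0 :: 'a::field_char_0)" "pochhammer (2/3) k \<noteq> (0 :: 'a)"
proof -
  have *: "of_nat c / 3 \<noteq> - (of_nat n :: 'a)" if "c > 0" for c n
  proof
    assume "of_nat c / 3 = - (of_nat n :: 'a)"
    then have "of_nat (c + 3 * n) = (0 :: 'a)" by (simp add: field_simps)
    then show False using that by (simp only: of_nat_eq_0_iff)
  qed
  show "pochhammer (1/3) k \<noteq> (0 :: 'a)" "pochhammer (2/3) k \<noteq> (0 :: 'a)"
    using *[of 1] *[of 2] by (auto simp: pochhammer_eq_0_iff)
qed

text \<open>Smoothness is available for \<open>f\<close>, a coefficient of a power of the cube root;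
  division by the nonzero constant hands it on to \<open>g\<close>, built from diagonal values of
  Hadamard coefficients.\<close>

lemma Dx_cmult_eq:
  fixes f g :: "real \<Rightarrow> 'a::real_normed_field"
  assumes "open X" "x \<in> X" "\<And>z. z \<in> X \<Longrightarrow> f z = c * g z" "smooth_at x f" "c \<noteq> 0"
  shows "Dx f x = c * Dx g x"
proof -
  have "eventually (\<lambda>z. inverse c * f z = g z) (nhds x)"
    using assms by (intro eventually_nhds_openI[of X]) auto
  then have "smooth_at x g"
    by (rule smooth_at_cong) (rule smooth_at_cmult[OF assms(4)])
  then have "Dx (\<lambda>z. c * g z) x = c * Dx g x"
    by (simp add: Dx_mult smooth_at_imp_differentiable Dx_const)
  moreover have "Dx f x = Dx (\<lambda>z. c * g z) x"
    using assms by (intro Dx_cong_nhds eventually_nhds_openI[of X]) auto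
  ultimately show ?thesis by simp
qed

text \<open>Only the coefficients of order 1 and 0 carry information. At every other order the
  operator is constant in time and the commutator vanishes.\<close>

lemma boussinesq_flow_iff:
  fixes X :: "real set" and u0 u1 :: "(nat \<Rightarrow> real) \<Rightarrow> real \<Rightarrow> 'a::real_normed_field"
  assumes X: "open X"
    and u0: "\<And>s. s \<in> T \<Longrightarrow> smooth_on X (u0 s)"
    and u1: "\<And>s. s \<in> T \<Longrightarrow> smooth_on X (u1 s)"
    and L: "\<And>s. L s = Lop (u0 s) (u1 s)"
    and P: "\<And>s. s \<in> T \<Longrightarrow> is_cube_root X (L s) (P s)"
  shows "boussinesq_flow T X L P m \<longleftrightarrow>
    (\<forall>s\<in>T. \<forall>x\<in>X. time_deriv m (\<lambda>s. u1 s x) s = 3 * Dx (psido_power (P s) m (- 1)) x \<and>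
      time_deriv m (\<lambda>s. u0 s x) s =
        3 * Dx (\<lambda>z. Dx (psido_power (P s) m (- 1)) z + psido_power (P s) m (- 2) z) x)"
proof -
  have td: "time_deriv m (\<lambda>s. L s i x) s =
    (if i = 1 then time_deriv m (\<lambda>s. u1 s x) s else if i = 0 then time_deriv m (\<lambda>s. u0 s x) s else 0)" for s i x
    by (cases "i = 3") (simp_all add: L Lop_def time_deriv_def)
  have "(\<forall>i. time_deriv m (\<lambda>s. L s i x) s = psido_commutator (psido_plus (psido_power (P s) m)) (L s) i x) \<longleftrightarrow>
    time_deriv m (\<lambda>s. u1 s x) s = 3 * Dx (psido_power (P s) m (- 1)) x \<and>
      time_deriv m (\<lambda>s. u0 s x) s =
        3 * Dx (\<lambda>z. Dx (psido_power (P s) m (- 1)) z + psido_power (P s) m (- 2) z) x"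
    if "s \<in> T" "x \<in> X" for s x
    unfolding td using psido_power_commutator[OF X u0[OF that(1)] u1[OF that(1)] P[OF that(1), unfolded L] that(2)]
    by (auto simp: L split: if_splits)
  then show ?thesis
    unfolding boussinesq_flow_def psido_eq_def by blast
qed

theorem proposition5p3:
  fixes X :: "real set"
    and T :: "(nat \<Rightarrow> real) set"
    and u0 u1 :: "(nat \<Rightarrow> real) \<Rightarrow> real \<Rightarrow> 'a::real_normed_field"
    and L P :: "(nat \<Rightarrow> real) \<Rightarrow> 'a psido"
    and H :: "(nat \<Rightarrow> real) \<Rightarrow> nat \<Rightarrow> nat \<Rightarrow> real \<Rightarrow> real \<Rightarrow> 'a"
  assumes X: "open X"
    and smooth_u0: "\<And>s. s \<in> T \<Longrightarrow> smooth_on X (u0 s)"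
    and smooth_u1: "\<And>s. s \<in> T \<Longrightarrow> smooth_on X (u1 s)"
    and time_u0: "\<And>s m x. s \<in> T \<Longrightarrow> m \<ge> 1 \<Longrightarrow> x \<in> X \<Longrightarrow> time_differentiable m (\<lambda>s. u0 s x) s"
    and time_u1: "\<And>s m x. s \<in> T \<Longrightarrow> m \<ge> 1 \<Longrightarrow> x \<in> X \<Longrightarrow> time_differentiable m (\<lambda>s. u1 s x) s"
    and L: "\<And>s. L s = Lop (u0 s) (u1 s)"
    and P: "\<And>s. s \<in> T \<Longrightarrow> is_cube_root X (L s) (P s)"
    and H: "\<And>s. s \<in> T \<Longrightarrow> hadamard_coefficients X (u0 s) (u1 s) (H s)"
  shows "\<forall>k\<ge>1.
    (boussinesq_flow T X L P (3 * k - 2) \<longleftrightarrow>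
      (\<forall>s\<in>T. \<forall>x\<in>X.
         time_deriv (3 * k - 2) (\<lambda>s. u1 s x) s
           = 3 * pochhammer (1/3) k * Dx (\<lambda>x. H s k 1 x x) x \<and>
         time_deriv (3 * k - 2) (\<lambda>s. u0 s x) s
           = 3 * pochhammer (1/3) k * Dx (\<lambda>x. H s k 0 x x + Dx (\<lambda>x'. H s k 1 x' x) x) x)) \<and>
    (boussinesq_flow T X L P (3 * k - 1) \<longleftrightarrow>
      (\<forall>s\<in>T. \<forall>x\<in>X.
         time_deriv (3 * k - 1) (\<lambda>s. u1 s x) s
           = 3 * pochhammer (2/3) k * Dx (\<lambda>x. H s k 0 x x) x \<and>
         time_deriv (3 * k - 1) (\<lambda>s. u0 s x) s
           = 3 * pochhammer (2/3) k * Dx (\<lambda>x. Dx (\<lambda>x'. H s k 0 x' x) x) x)) \<and>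
    (\<forall>s\<in>T. psido_eq X (psido_commutator (psido_plus (psido_power (P s) (3 * k))) (L s))
                      (\<lambda>i x. 0))"
proof (intro allI impI conjI)
  have flow: "boussinesq_flow T X L P m \<longleftrightarrow>
    (\<forall>s\<in>T. \<forall>x\<in>X. time_deriv m (\<lambda>s. u1 s x) s = 3 * Dx (psido_power (P s) m (- 1)) x \<and>
      time_deriv m (\<lambda>s. u0 s x) s =
        3 * Dx (\<lambda>z. Dx (psido_power (P s) m (- 1)) z + psido_power (P s) m (- 2) z) x)" for m
    using X smooth_u0 smooth_u1 L P by (rule boussinesq_flow_iff)
  note cube = P[unfolded L]
  fix k :: nat
  assume k: "k \<ge> 1"
  \<comment> \<open>The identities of \<open>psido_power_eq_hadamard\<close> hold throughout the
    open set \<open>X\<close> and can therefore be differentiated once more.\<close>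
  have had: "Dx (psido_power (P s) (3 * k - 2) (- 1)) x = pochhammer (1/3) k * Dx (\<lambda>x. H s k 1 x x) x"
    "Dx (\<lambda>z. Dx (psido_power (P s) (3 * k - 2) (- 1)) z + psido_power (P s) (3 * k - 2) (- 2) z) x =
      pochhammer (1/3) k * Dx (\<lambda>x. H s k 0 x x + Dx (\<lambda>x'. H s k 1 x' x) x) x"
    "Dx (psido_power (P s) (3 * k - 1) (- 1)) x = pochhammer (2/3) k * Dx (\<lambda>x. H s k 0 x x) x"
    "Dx (\<lambda>z. Dx (psido_power (P s) (3 * k - 1) (- 1)) z + psido_power (P s) (3 * k - 1) (- 2) z) x =
      pochhammer (2/3) k * Dx (\<lambda>x. Dx (\<lambda>x'. H s k 0 x' x) x) x"
    if s: "s \<in> T" and x: "x \<in> X" for s x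
  proof -
    note eq = psido_power_eq_hadamard[OF X smooth_u0[OF s] smooth_u1[OF s] cube[OF s] H[OF s] k]
    note sm = psido_power_smooth[OF X smooth_u0[OF s] smooth_u1[OF s] cube[OF s] x]
    note sm' = smooth_at_add[OF smooth_at_Dx[OF sm] sm]
    show "Dx (psido_power (P s) (3 * k - 2) (- 1)) x = pochhammer (1/3) k * Dx (\<lambda>x. H s k 1 x x) x"
      by (rule Dx_cmult_eq[OF X x eq(1) sm pochhammer_third_nonzero(1)])
    show "Dx (\<lambda>z. Dx (psido_power (P s) (3 * k - 2) (- 1)) z + psido_power (P s) (3 * k - 2) (- 2) z) x =
      pochhammer (1/3) k * Dx (\<lambda>x. H s k 0 x x + Dx (\<lambda>x'. H s k 1 x' x) x) x"
      by (rule Dx_cmult_eq[OF X x eq(2) sm' pochhammer_third_nonzero(1)])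
    show "Dx (psido_power (P s) (3 * k - 1) (- 1)) x = pochhammer (2/3) k * Dx (\<lambda>x. H s k 0 x x) x"
      by (rule Dx_cmult_eq[OF X x eq(3) sm pochhammer_third_nonzero(2)])
    show "Dx (\<lambda>z. Dx (psido_power (P s) (3 * k - 1) (- 1)) z + psido_power (P s) (3 * k - 1) (- 2) z) x =
      pochhammer (2/3) k * Dx (\<lambda>x. Dx (\<lambda>x'. H s k 0 x' x) x) x"
      by (rule Dx_cmult_eq[OF X x eq(4) sm' pochhammer_third_nonzero(2)])
  qed
  show "boussinesq_flow T X L P (3 * k - 2) \<longleftrightarrow>
      (\<forall>s\<in>T. \<forall>x\<in>X.
         time_deriv (3 * k - 2) (\<lambda>s. u1 s x) s
           = 3 * pochhammer (1/3) k * Dx (\<lambda>x. H s k 1 x x) x \<and>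
         time_deriv (3 * k - 2) (\<lambda>s. u0 s x) s
           = 3 * pochhammer (1/3) k * Dx (\<lambda>x. H s k 0 x x + Dx (\<lambda>x'. H s k 1 x' x) x) x)"
    unfolding flow mult.assoc by (intro ball_cong refl) (simp only: had)
  show "boussinesq_flow T X L P (3 * k - 1) \<longleftrightarrow>
      (\<forall>s\<in>T. \<forall>x\<in>X.
         time_deriv (3 * k - 1) (\<lambda>s. u1 s x) s
           = 3 * pochhammer (2/3) k * Dx (\<lambda>x. H s k 0 x x) x \<and>
         time_deriv (3 * k - 1) (\<lambda>s. u0 s x) s
           = 3 * pochhammer (2/3) k * Dx (\<lambda>x. Dx (\<lambda>x'. H s k 0 x' x) x) x)"
    unfolding flow mult.assoc by (intro ball_cong refl) (simp only: had)
  show "\<forall>s\<in>T. psido_eq X (psido_commutator (psido_plus (psido_power (P s) (3 * k))) (L s)) (\<lambda>i x. 0)"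
    unfolding psido_eq_def
  proof (intro ballI allI)
    fix s i x assume s: "s \<in> T" and x: "x \<in> X"
    note eq = psido_power_eq_hadamard[OF X smooth_u0[OF s] smooth_u1[OF s] cube[OF s] H[OF s] k]
    \<comment> \<open>Both functions under the derivative in the commutator formula vanish
      identically on \<open>X\<close>, not merely at \<open>x\<close>.\<close>
    have "Dx f x = 0" if "\<And>z. z \<in> X \<Longrightarrow> f z = 0" for f :: "real \<Rightarrow> 'a"
      using funpow_Dx_eq_0[OF X that x, where i = 1] by simp
    from this[OF eq(5)] this[OF eq(6)]
    show "psido_commutator (psido_plus (psido_power (P s) (3 * k))) (L s) i x = 0"
      using psido_power_commutator[OF X smooth_u0[OF s] smooth_u1[OF s] cube[OF s] x, where m = "3 * k" and i = i]
      by (simp add: L)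
  qed
qed

end
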